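(* Let $G$ be a finite group and let $(\Gamma,\Psi)$ be a $G$-gain graph with $n$ vertices. Let $A^+\in M_n(\mathbb{C})$ be the adjacency matrix of the underlying graph $\Gamma$. The following are equivalent: (i) $(\Gamma,\Psi)$ is balanced; (ii) $\sigma(A_\pi)=\deg(\pi)\,\sigma(A^+)$ (i.e. $\sigma(A_\pi)$ consists of $\deg(\pi)$ copies of $\sigma(A^+)$) for every unitary irreducible representation $\pi$ of $G$. Moreover, if $\Gamma$ is connected, the following is also equivalent to (i) and (ii): (iii) $\lambda_1(A_\pi)=\lambda_1(A^+)$ with multiplicity $\deg(\pi)$ (as an eigenvalue of $A_\pi$), for every unitary irreducible representation $\pi$ of $G$.
   Context: $\Gamma=(V_\Gamma,E_\Gamma)$ is a finite simple graph (no loops, no multiple edges) whose edges are regarded as ordered pairs, with $(v,u)\in E_\Gamma$ if and only if $(u,v)\in E_\Gamma$; write $u\sim v$ if $(u,v)\in E_\Gamma$. A $G$-gain function is a map $\Psi\colon E_\Gamma\to G$ with $\Psi(u,v)=\Psi(v,u)^{-1}$; the pair $(\Gamma,\Psi)$ is a $G$-gain graph. Fix an order $v_1,\dots,v_n$ of $V_\Gamma$. A walk is a sequence of vertices $w_0,\dots,w_h$ with $w_i\sim w_{i+1}$; its gain is $\Psi(w_0,w_1)\cdots\Psi(w_{h-1},w_h)$; it is closed if $w_0=w_h$. $(\Gamma,\Psi)$ is balanced if every closed walk has gain $1_G$, the identity of $G$. Representations are finite-dimensional and complex, viewed as homomorphisms $\pi\colon G\to GL_k(\mathbb{C})$ with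 $\deg(\pi)=k$; $\pi$ is unitary if each $\pi(g)$ is a unitary matrix. For such $\pi$, the represented adjacency matrix $A_\pi\in M_{nk}(\mathbb{C})$ of $(\Gamma,\Psi)$ is the $n\times n$ block matrix with $k\times k$ blocks whose $(i,j)$ block is $\pi(\Psi(v_i,v_j))$ if $(v_i,v_j)\in E_\Gamma$ and the zero block otherwise. (For unitary $\pi$ this matrix is Hermitian.) $\sigma(\cdot)$ denotes the spectrum as a multiset, and $\lambda_1(M)$ is the largest eigenvalue of a Hermitian matrix $M$. *)

theory Defs
  imports
    "Graph_Theory.Graph_Theory"
    "Jordan_Normal_Form.Schur_Decomposition"
    "Jordan_Normal_Form.Spectral_Radius"
begin

text \<open>
  A finite simple graph is a \<^locale>\<open>pair_graph\<close>: finitely many vertices, and a symmetric and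
  irreflexive set of ordered pairs as arcs.
\<close>

definition gain_function ::
  "('g, 'm) monoid_scheme \<Rightarrow> 'v pair_pre_digraph \<Rightarrow> ('v \<times> 'v \<Rightarrow> 'g) \<Rightarrow> bool" where
  "gain_function G \<Gamma> \<Psi> \<longleftrightarrow>
     \<Psi> \<in> parcs \<Gamma> \<rightarrow> carrier G \<and>
     (\<forall>u v. (u, v) \<in> parcs \<Gamma> \<longrightarrow> \<Psi> (u, v) = inv\<^bsub>G\<^esub> \<Psi> (v, u))"

text \<open>Walks are vertex lists; a one-vertex walk has the empty product as its gain.\<close>

definition walk_gain ::
  "('g, 'm) monoid_scheme \<Rightarrow> ('v \<times> 'v \<Rightarrow> 'g) \<Rightarrow> 'v list \<Rightarrow> 'g" where
  "walk_gain G \<Psi> w = foldr (\<lambda>e g. \<Psi> e \<otimes>\<^bsub>G\<^esub> g) (vwalk_arcs w) \<one>\<^bsub>G\<^esub>"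

definition balanced ::
  "('g, 'm) monoid_scheme \<Rightarrow> 'v pair_pre_digraph \<Rightarrow> ('v \<times> 'v \<Rightarrow> 'g) \<Rightarrow> bool" where
  "balanced G \<Gamma> \<Psi> \<longleftrightarrow>
     (\<forall>w. vwalk w (with_proj \<Gamma>) \<and> hd w = last w \<longrightarrow> walk_gain G \<Psi> w = \<one>\<^bsub>G\<^esub>)"

definition general_linear_group :: "nat \<Rightarrow> complex mat monoid" where
  "general_linear_group k = units_of (ring_mat TYPE(complex) k ())"

definition representation ::
  "('g, 'm) monoid_scheme \<Rightarrow> nat \<Rightarrow> ('g \<Rightarrow> complex mat) \<Rightarrow> bool" where
  "representation G k \<pi> \<longleftrightarrow> \<pi> \<in> hom G (general_linear_group k)"

definition unitary_mat :: "nat \<Rightarrow> complex mat \<Rightarrow> bool" where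
  "unitary_mat k U \<longleftrightarrow>
     U \<in> carrier_mat k k \<and> U * mat_adjoint U = 1\<^sub>m k \<and> mat_adjoint U * U = 1\<^sub>m k"

definition unitary_representation ::
  "('g, 'm) monoid_scheme \<Rightarrow> nat \<Rightarrow> ('g \<Rightarrow> complex mat) \<Rightarrow> bool" where
  "unitary_representation G k \<pi> \<longleftrightarrow>
     representation G k \<pi> \<and> (\<forall>g \<in> carrier G. unitary_mat k (\<pi> g))"

text \<open>The representation on the zero space does not count as irreducible.\<close>

definition irreducible_representation ::
  "('g, 'm) monoid_scheme \<Rightarrow> nat \<Rightarrow> ('g \<Rightarrow> complex mat) \<Rightarrow> bool" where
  "irreducible_representation G k \<pi> \<longleftrightarrow>
     representation G k \<pi> \<and> k > 0 \<and>
     (\<forall>W. VectorSpace.subspace class_ring W (module_vec TYPE(complex) k) \<and>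
          (\<forall>g \<in> carrier G. \<forall>w \<in> W. \<pi> g *\<^sub>v w \<in> W) \<longrightarrow>
          W = {0\<^sub>v k} \<or> W = carrier_vec k)"

text \<open>
  In the next two definitions the list \<open>vs\<close> enumerates the vertices.  Row \<open>i\<close> of the represented
  adjacency matrix is row \<open>i mod k\<close> of block row \<open>i div k\<close>, and likewise for columns.
\<close>

definition adjacency_matrix :: "'v pair_pre_digraph \<Rightarrow> 'v list \<Rightarrow> complex mat" where
  "adjacency_matrix \<Gamma> vs = mat (length vs) (length vs)
     (\<lambda>(i, j). if (vs ! i, vs ! j) \<in> parcs \<Gamma> then 1 else 0)"

definition represented_adjacency_matrix ::
  "'v pair_pre_digraph \<Rightarrow> ('v \<times> 'v \<Rightarrow> 'g) \<Rightarrow> 'v list \<Rightarrow> nat \<Rightarrow> ('g \<Rightarrow> complex mat) \<Rightarrow> complex mat"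
  where
  "represented_adjacency_matrix \<Gamma> \<Psi> vs k \<pi> = mat (length vs * k) (length vs * k)
     (\<lambda>(i, j).
        if (vs ! (i div k), vs ! (j div k)) \<in> parcs \<Gamma>
        then \<pi> (\<Psi> (vs ! (i div k), vs ! (j div k))) $$ (i mod k, j mod k)
        else 0)"

text \<open>
  The spectrum as a multiset: eigenvalues with algebraic multiplicity.  For Hermitian matrices
  algebraic and geometric multiplicities agree.
\<close>

definition spectrum_mset :: "complex mat \<Rightarrow> complex multiset" where
  "spectrum_mset A = proots (char_poly A)"

text \<open>Only meaningful for Hermitian matrices of positive size, all of whose eigenvalues are real.\<close>

definition largest_eigenvalue :: "complex mat \<Rightarrow> real" where
  "largest_eigenvalue A = Max {x. eigenvalue A (complex_of_real x)}"

end

theory Submission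
  imports Defs
begin

text \<open>
  The trace of \<open>A\<^sub>\<pi>\<^sup>h\<close> is the sum of \<open>tr \<pi>(g)\<close> over the gains \<open>g\<close> of the closed walks of length
  \<open>h\<close>, and \<open>A\<^sup>+\<close> is the case of the trivial representation.  Since these matrices are Hermitian, the
  traces of all powers determine the spectrum, which gives (i) \<open>\<Rightarrow>\<close> (ii).  Conversely, the real part
  of the trace of a unitary matrix of size \<open>k\<close> is at most \<open>k\<close>, with equality only for the identity, so
  under (ii) every gain of a closed walk is killed by all irreducible unitary representations; these
  separate the points of a finite group.

  If \<open>\<Gamma>\<close> is connected, \<open>A\<^sup>+\<close> has a positive top eigenvector \<open>p\<close>.  Writing a \<open>\<lambda>\<^sub>1(A\<^sup>+)\<close>-eigenvector
  of \<open>A\<^sub>\<pi>\<close> as \<open>x\<^sub>i = p\<^sub>i y\<^sub>i\<close>, one finds \<open>y\<^sub>i = \<pi>(\<Psi>(i, j)) y\<^sub>j\<close> along every arc.  Hence \<open>x\<close> is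
  determined by its block at a single vertex, the multiplicity is at most \<open>deg \<pi>\<close>, and if it equals
  \<open>deg \<pi>\<close> then the gain of each closed walk acts as the identity on all of \<open>\<complex>\<^sup>k\<close>.
\<close>

section \<open>Linear algebra over the complex numbers\<close>

text \<open>Balance controls the spectrum of every unitary representation at once. The converse only
  has the irreducible ones at hand, so it needs enough of them. They come from the regular
  representation, which is faithful: among all unitary representations in which a given element acts
  nontrivially, one of least degree is taken, and no decomposition into irreducibles is ever built.
  This descent and the spectral theorem both work with orthonormal lists of maximal length in place
  of dimension theory: lengths are bounded by n, and a suitable nonzero vector orthogonal to the
  list would prolong it.

  Both converses treat one representation at a time: spectral data of its matrix force all gains of
  closed walks into its kernel. For the passage from the full spectrum to the multiplicity of the
  top eigenvalue, that eigenvalue of the plain adjacency matrix has to be simple, which is the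
  multiplicity bound for the trivial representation of degree 1. Connectedness lets the top
  eigenvalue see the whole graph; otherwise it may belong to one component and say nothing about the
  gains in the others.\<close>

lemma mat_adjoint_carrier [simp]:
  "A \<in> carrier_mat r c \<Longrightarrow> mat_adjoint A \<in> carrier_mat c r"
  by (auto simp: mat_adjoint_def)

lemma mat_adjoint_dim [simp]:
  "dim_row (mat_adjoint A) = dim_col A" "dim_col (mat_adjoint A) = dim_row A"
  by (auto simp: mat_adjoint_def)

lemma mat_adjoint_index [simp]:
  fixes A :: "complex mat"
  assumes "i < dim_col A" "j < dim_row A"
  shows "mat_adjoint A $$ (i, j) = cnj (A $$ (j, i))"
  using assms by (simp add: mat_adjoint_def mat_of_rows_index)

lemma mat_adjoint_adjoint [simp]: "mat_adjoint (mat_adjoint A) = (A :: complex mat)"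
  by (rule eq_matI) auto

lemma mat_adjoint_one [simp]: "mat_adjoint (1\<^sub>m n) = (1\<^sub>m n :: complex mat)"
  by (rule eq_matI) auto

lemma mat_adjoint_mult:
  fixes A B :: "complex mat"
  assumes "A \<in> carrier_mat r m" "B \<in> carrier_mat m c"
  shows "mat_adjoint (A * B) = mat_adjoint B * mat_adjoint A"
  using assms by (intro eq_matI) (auto simp: scalar_prod_def mult.commute)

lemma cscalar_prod_adjoint:
  fixes A :: "complex mat"
  assumes "A \<in> carrier_mat r c" "x \<in> carrier_vec c" "y \<in> carrier_vec r"
  shows "(A *\<^sub>v x) \<bullet>c y = x \<bullet>c (mat_adjoint A *\<^sub>v y)"
proof -
  have "(A *\<^sub>v x) \<bullet>c y = (\<Sum>i<r. \<Sum>j<c. A $$ (i, j) * x $ j * cnj (y $ i))"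
    using assms by (auto simp: scalar_prod_def lessThan_atLeast0 sum_distrib_right)
  also have "\<dots> = (\<Sum>j<c. \<Sum>i<r. A $$ (i, j) * x $ j * cnj (y $ i))"
    by (rule sum.swap)
  also have "\<dots> = x \<bullet>c (mat_adjoint A *\<^sub>v y)"
    using assms by (auto simp: scalar_prod_def lessThan_atLeast0 sum_distrib_left mult_ac)
  finally show ?thesis .
qed

lemma cscalar_prod_commute:
  fixes v w :: "complex vec"
  assumes "v \<in> carrier_vec n" "w \<in> carrier_vec n"
  shows "v \<bullet>c w = cnj (w \<bullet>c v)"
  using assms by (simp add: scalar_prod_def mult.commute)

lemma cscalar_prod_self:
  fixes v :: "complex vec"
  shows "v \<bullet>c v = complex_of_real (\<Sum>i<dim_vec v. (cmod (v $ i))\<^sup>2)"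
  by (simp add: scalar_prod_def lessThan_atLeast0 complex_norm_square flip: of_real_power)

lemma mult_mat_zero_vec:
  "A \<in> carrier_mat r c \<Longrightarrow> A *\<^sub>v 0\<^sub>v c = (0\<^sub>v r :: 'a :: semiring_0 vec)"
  by (intro eq_vecI) auto

lemma smult_vec_zero: "a \<cdot>\<^sub>v 0\<^sub>v n = (0\<^sub>v n :: 'a :: mult_zero vec)"
  by (intro eq_vecI) auto

lemma smult_mat_mult_vec:
  assumes "A \<in> carrier_mat r c" "v \<in> carrier_vec c"
  shows "(a \<cdot>\<^sub>m A) *\<^sub>v v = a \<cdot>\<^sub>v (A *\<^sub>v v :: 'a :: comm_semiring_0 vec)"
  using assms by (intro eq_vecI) (auto simp: scalar_prod_def sum_distrib_left mult.assoc)

lemma minus_vec_eq_0: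
  fixes u v :: "'a :: group_add vec"
  assumes "u \<in> carrier_vec n" "v \<in> carrier_vec n" "u - v = 0\<^sub>v n"
  shows "u = v"
proof (rule eq_vecI)
  fix i assume "i < dim_vec v"
  then have "(u - v) $ i = 0" "i < dim_vec v" using assms by simp_all
  then show "u $ i = v $ i" by simp
qed (use assms in auto)

text \<open>Padding \<open>M\<close> with zero rows gives a square matrix \<open>N\<close> whose
  last row is zero. So \<open>N\<close> is singular, and a kernel vector of \<open>N\<close> is one
  of \<open>M\<close>.\<close>

lemma wide_matrix_kernel:
  fixes M :: "'a :: field mat"
  assumes M: "M \<in> carrier_mat r c" and "r < c"
  obtains v where "v \<in> carrier_vec c" "v \<noteq> 0\<^sub>v c" "M *\<^sub>v v = 0\<^sub>v r"
proof -
  define N where "N = mat c c (\<lambda>(i, j). if i < r then M $$ (i, j) else 0)"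
  have N: "N \<in> carrier_mat c c" by (simp add: N_def)
  have "transpose_mat N *\<^sub>v unit_vec c (c - 1) = 0\<^sub>v c"
    using assms by (intro eq_vecI) (auto simp: N_def)
  moreover have "unit_vec c (c - 1) \<noteq> (0\<^sub>v c :: 'a vec)"
    using assms by (auto simp: vec_eq_iff)
  ultimately have "det (transpose_mat N) = 0"
    using N assms by (subst det_0_iff_vec_prod_zero_field[of _ c])
      (auto intro!: exI[of _ "unit_vec c (c - 1)"])
  then have "det N = 0" using det_transpose[OF N] by simp
  then obtain v where v: "v \<in> carrier_vec c" "v \<noteq> 0\<^sub>v c" "N *\<^sub>v v = 0\<^sub>v c"
    using det_0_iff_vec_prod_zero_field[OF N] by auto
  have "M *\<^sub>v v = 0\<^sub>v r"
  proof (rule eq_vecI)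
    fix i assume "i < dim_vec (0\<^sub>v r :: 'a vec)"
    then have i: "i < r" by simp
    then have "row N i = row M i"
      using assms by (intro eq_vecI) (auto simp: N_def)
    then have "(M *\<^sub>v v) $ i = (N *\<^sub>v v) $ i"
      using i assms N by auto
    then show "(M *\<^sub>v v) $ i = 0\<^sub>v r $ i" using v i assms by simp
  qed (use M in auto)
  with v that show ?thesis by blast
qed

section \<open>Orthonormal lists of complex vectors\<close>

definition orthonormal :: "nat \<Rightarrow> complex vec list \<Rightarrow> bool" where
  "orthonormal n us \<longleftrightarrow> set us \<subseteq> carrier_vec n \<and>
     mat_adjoint (mat_of_cols n us) * mat_of_cols n us = 1\<^sub>m (length us)"

lemma adjoint_mat_of_cols_mult_vec:
  fixes us :: "complex vec list"
  assumes "set us \<subseteq> carrier_vec n" "x \<in> carrier_vec n" "i < length us"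
  shows "(mat_adjoint (mat_of_cols n us) *\<^sub>v x) $ i = x \<bullet>c us ! i"
proof -
  have "us ! i \<in> carrier_vec n" using assms by auto
  then show ?thesis
    using assms
    by (auto simp: scalar_prod_def mat_of_cols_index mult.commute intro!: sum.cong)
qed

text \<open>The Gram matrix in the definition suits matrix identities; the entrywise form given here
  suits lists that are built vector by vector.\<close>

lemma orthonormal_iff:
  "orthonormal n us \<longleftrightarrow> set us \<subseteq> carrier_vec n \<and>
     (\<forall>i<length us. \<forall>j<length us. us ! i \<bullet>c us ! j = (if i = j then 1 else 0))"
proof -
  let ?U = "mat_of_cols n us"
  have "(mat_adjoint ?U * ?U = 1\<^sub>m (length us)) \<longleftrightarrow>
     (\<forall>i<length us. \<forall>j<length us. us ! i \<bullet>c us ! j = (if i = j then 1 else 0))"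
    if "set us \<subseteq> carrier_vec n"
  proof -
    have "(mat_adjoint ?U * ?U) $$ (j, i) = us ! i \<bullet>c us ! j"
      if "i < length us" "j < length us" for i j
    proof -
      have c: "us ! i \<in> carrier_vec n" using that \<open>set us \<subseteq> _\<close> by auto
      then have "col ?U i = us ! i" using that by simp
      then have "(mat_adjoint ?U * ?U) $$ (j, i) = (mat_adjoint ?U *\<^sub>v (us ! i)) $ j"
        using that by simp
      also have "\<dots> = us ! i \<bullet>c us ! j"
        using adjoint_mat_of_cols_mult_vec[OF \<open>set us \<subseteq> _\<close> c] that by simp
      finally show ?thesis .
    qed
    then show ?thesis by (auto simp: mat_eq_iff)
  qed
  then show ?thesis unfolding orthonormal_def by auto
qed

lemma orthonormal_Nil [simp]: "orthonormal n []"
  by (simp add: orthonormal_iff)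

lemma orthonormal_snoc:
  assumes us: "orthonormal n us" and v: "v \<in> carrier_vec n" "v \<bullet>c v = 1"
    and orth: "\<And>u. u \<in> set us \<Longrightarrow> v \<bullet>c u = 0"
  shows "orthonormal n (us @ [v])"
proof -
  have "u \<bullet>c v = 0" if "u \<in> set us" for u
  proof -
    have "u \<in> carrier_vec n" using us that by (auto simp: orthonormal_iff)
    then show ?thesis using cscalar_prod_commute[of u n v] v orth[OF that] by simp
  qed
  then show ?thesis
    using us v orth by (auto simp: orthonormal_iff nth_append less_Suc_eq)
qed

lemma orthonormal_append:
  assumes "orthonormal n (us @ ws)"
  shows "orthonormal n us" and "orthonormal n ws"
    and "\<And>u w. u \<in> set us \<Longrightarrow> w \<in> set ws \<Longrightarrow> u \<bullet>c w = 0"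
proof -
  have *: "(us @ ws) ! i \<bullet>c (us @ ws) ! j = (if i = j then 1 else 0)"
    if "i < length us + length ws" "j < length us + length ws" for i j
    using assms that by (auto simp: orthonormal_iff)
  have "us ! i \<bullet>c us ! j = (if i = j then 1 else 0)" if "i < length us" "j < length us" for i j
    using *[of i j] that by (auto simp: nth_append)
  then show "orthonormal n us" using assms by (auto simp: orthonormal_iff)
  have "ws ! i \<bullet>c ws ! j = (if i = j then 1 else 0)" if "i < length ws" "j < length ws" for i j
    using *[of "length us + i" "length us + j"] that by (auto simp: nth_append)
  then show "orthonormal n ws" using assms by (auto simp: orthonormal_iff)
  show "u \<bullet>c w = 0" if "u \<in> set us" "w \<in> set ws" for u w
  proof -
    from that obtain i j where "i < length us" "us ! i = u" "j < length ws" "ws ! j = w"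
      by (auto simp: in_set_conv_nth)
    then show ?thesis using *[of i "length us + j"] by (auto simp: nth_append)
  qed
qed

lemma orthonormal_normalize:
  assumes us: "orthonormal n us" and v: "v \<in> carrier_vec n" "v \<noteq> 0\<^sub>v n"
    and orth: "\<And>u. u \<in> set us \<Longrightarrow> v \<bullet>c u = 0"
  obtains a where "a \<noteq> 0" "orthonormal n (us @ [a \<cdot>\<^sub>v v])"
proof -
  define s where "s = (\<Sum>i<dim_vec v. (cmod (v $ i))\<^sup>2)"
  have vv: "v \<bullet>c v = complex_of_real s"
    unfolding s_def by (rule cscalar_prod_self)
  have "v \<bullet>c v \<noteq> 0" using v by simp
  then have "s \<noteq> 0" using vv by auto
  moreover have "s \<ge> 0" unfolding s_def by (intro sum_nonneg) auto
  ultimately have s: "s > 0" by simp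
  define a where "a = complex_of_real (1 / sqrt s)"
  have "a \<noteq> 0" using s by (simp add: a_def)
  have aa: "a * cnj a * complex_of_real s = 1"
  proof -
    have "a * cnj a * complex_of_real s = complex_of_real ((1 / sqrt s) * (1 / sqrt s) * s)"
      unfolding a_def by (simp only: complex_cnj_complex_of_real of_real_mult)
    also have "(1 / sqrt s) * (1 / sqrt s) * s = 1"
      using s by (simp add: field_simps flip: power2_eq_square)
    finally show ?thesis by simp
  qed
  have "orthonormal n (us @ [a \<cdot>\<^sub>v v])"
  proof (rule orthonormal_snoc[OF us])
    show "(a \<cdot>\<^sub>v v) \<bullet>c (a \<cdot>\<^sub>v v) = 1"
      using v vv aa by (simp add: conjugate_smult_vec mult_ac)
    show "(a \<cdot>\<^sub>v v) \<bullet>c u = 0" if "u \<in> set us" for u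
    proof -
      have "u \<in> carrier_vec n" using us that by (auto simp: orthonormal_iff)
      then show ?thesis using orth[OF that] v by simp
    qed
  qed (use v in auto)
  with \<open>a \<noteq> 0\<close> that show ?thesis by blast
qed

lemma orthonormal_full_unitary:
  assumes "orthonormal n us" "length us = n"
  shows "mat_of_cols n us \<in> carrier_mat n n"
    and "mat_adjoint (mat_of_cols n us) * mat_of_cols n us = 1\<^sub>m n"
    and "mat_of_cols n us * mat_adjoint (mat_of_cols n us) = 1\<^sub>m n"
proof -
  show c: "mat_of_cols n us \<in> carrier_mat n n"
    using assms(2) mat_of_cols_carrier(1)[of n us] by simp
  show *: "mat_adjoint (mat_of_cols n us) * mat_of_cols n us = 1\<^sub>m n"
    using assms by (simp add: orthonormal_def)
  show "mat_of_cols n us * mat_adjoint (mat_of_cols n us) = 1\<^sub>m n"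
    using mat_mult_left_right_inverse[OF _ c *] c by simp
qed

text \<open>The entries of \<open>mat_adjoint U\<close> applied to \<open>v\<close> are the inner
  products with the list, and the square matrix \<open>U\<close> recovers \<open>v\<close> from
  them.\<close>

lemma orthonormal_full_total:
  assumes "orthonormal n us" "length us = n" and v: "v \<in> carrier_vec n"
    and orth: "\<And>u. u \<in> set us \<Longrightarrow> v \<bullet>c u = 0"
  shows "v = 0\<^sub>v n"
proof -
  let ?U = "mat_of_cols n us"
  note U = orthonormal_full_unitary[OF assms(1,2)]
  have "mat_adjoint ?U *\<^sub>v v = 0\<^sub>v n"
    using adjoint_mat_of_cols_mult_vec[OF _ v] assms by (intro eq_vecI) (auto simp: orthonormal_def)
  then have "?U *\<^sub>v (mat_adjoint ?U *\<^sub>v v) = 0\<^sub>v n"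
    using U(1) by (auto intro!: eq_vecI simp: assms(2))
  moreover have "?U *\<^sub>v (mat_adjoint ?U *\<^sub>v v) = v"
    using assoc_mult_mat_vec[OF U(1) mat_adjoint_carrier[OF U(1)] v] U(3) v by simp
  ultimately show ?thesis by simp
qed

text \<open>In a longer list the first \<open>n\<close> vectors would already be total, so the next
  one would be zero, although its norm is 1.\<close>

lemma orthonormal_length:
  assumes us: "orthonormal n us" shows "length us \<le> n"
proof (rule ccontr)
  assume "\<not> length us \<le> n"
  then have n: "n < length us" by simp
  define vs v where "vs = take n us" and "v = us ! n"
  have us_eq: "us = vs @ v # drop (Suc n) us"
    using id_take_nth_drop[OF n] by (simp add: vs_def v_def)
  have *: "orthonormal n (vs @ v # drop (Suc n) us)" using us us_eq by simp
  have v: "v \<in> carrier_vec n" using us n by (auto simp: orthonormal_def v_def)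
  have "v \<bullet>c u = 0" if "u \<in> set vs" for u
  proof -
    have "u \<bullet>c v = 0" using orthonormal_append(3)[OF * that] by simp
    moreover have "u \<in> carrier_vec n"
      using that us by (auto simp: vs_def orthonormal_def dest: in_set_takeD)
    ultimately show ?thesis using cscalar_prod_commute[OF v, of u] by simp
  qed
  then have "v = 0\<^sub>v n"
    using orthonormal_full_total[OF orthonormal_append(1)[OF *] _ v] n by (simp add: vs_def)
  moreover have "v \<bullet>c v = 1" using us n by (simp add: orthonormal_iff v_def)
  ultimately show False by simp
qed

text \<open>A vector is orthogonal to the list iff the adjoint of its column matrix kills it; that
  adjoint has fewer rows than columns, hence a nonzero kernel.\<close>

lemma orthonormal_extend:
  assumes us: "orthonormal n us" and l: "length us < n"
  obtains v where "orthonormal n (us @ [v])"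
proof -
  let ?U = "mat_of_cols n us"
  have "mat_adjoint ?U \<in> carrier_mat (length us) n" by simp
  from wide_matrix_kernel[OF this l] obtain v where v: "v \<in> carrier_vec n" "v \<noteq> 0\<^sub>v n"
    "mat_adjoint ?U *\<^sub>v v = 0\<^sub>v (length us)" by blast
  have "v \<bullet>c u = 0" if "u \<in> set us" for u
  proof -
    from that obtain i where i: "i < length us" "us ! i = u" by (auto simp: in_set_conv_nth)
    have "set us \<subseteq> carrier_vec n" using us by (simp add: orthonormal_def)
    from adjoint_mat_of_cols_mult_vec[OF this v(1) i(1)] show ?thesis using i v(3) by simp
  qed
  from orthonormal_normalize[OF us v(1,2) this] that show ?thesis by blast
qed

lemma orthonormal_complete:
  assumes "orthonormal n us"
  obtains ws where "orthonormal n (us @ ws)" "length (us @ ws) = n"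
proof -
  have "orthonormal n us \<Longrightarrow> \<exists>ws. orthonormal n (us @ ws) \<and> length (us @ ws) = n" for us
  proof (induction "n - length us" arbitrary: us)
    case 0
    then show ?case using orthonormal_length[of n us] by (intro exI[of _ "[]"]) auto
  next
    case (Suc d)
    then obtain v where v: "orthonormal n (us @ [v])"
      using orthonormal_extend[of n us] by (metis zero_less_Suc zero_less_diff)
    have "d = n - length (us @ [v])" using Suc(2) by simp
    from Suc(1)[OF this v] show ?case by (metis append.assoc)
  qed
  with assms that show ?thesis by blast
qed

text \<open>Lengths of orthonormal lists are bounded, so a longest one with all members in
  \<open>P\<close> exists. Maximality is phrased for vectors of any length, which is why all nonzero
  multiples have to satisfy \<open>P\<close>. The instances are eigenvectors of a matrix and members
  of a subspace.\<close>

lemma maximal_orthonormal: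
  obtains us where "orthonormal n us" "\<And>u. u \<in> set us \<Longrightarrow> P u"
    "\<And>v. v \<in> carrier_vec n \<Longrightarrow> v \<noteq> 0\<^sub>v n \<Longrightarrow> (\<And>u. u \<in> set us \<Longrightarrow> v \<bullet>c u = 0) \<Longrightarrow>
       (\<And>a. a \<noteq> 0 \<Longrightarrow> P (a \<cdot>\<^sub>v v)) \<Longrightarrow> False"
proof -
  let ?Q = "\<lambda>us. orthonormal n us \<and> (\<forall>u\<in>set us. P u)"
  have "\<exists>us. ?Q us \<and> (\<forall>vs. ?Q vs \<longrightarrow> length vs \<le> length us)"
    by (rule ex_has_greatest_nat[of ?Q "[]" _ "Suc n"]) (auto dest: orthonormal_length)
  then obtain us where us: "?Q us" "\<And>vs. ?Q vs \<Longrightarrow> length vs \<le> length us" by blast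
  have False if v: "v \<in> carrier_vec n" "v \<noteq> 0\<^sub>v n" "\<And>u. u \<in> set us \<Longrightarrow> v \<bullet>c u = 0"
    "\<And>a. a \<noteq> 0 \<Longrightarrow> P (a \<cdot>\<^sub>v v)" for v
  proof -
    from us have "orthonormal n us" by simp
    from orthonormal_normalize[OF this v(1-3)] obtain a
      where "a \<noteq> 0" "orthonormal n (us @ [a \<cdot>\<^sub>v v])" by blast
    then show False using us(1) us(2)[of "us @ [a \<cdot>\<^sub>v v]"] v(4) by auto
  qed
  with us(1) that show ?thesis by blast
qed

section \<open>Hermitian matrices and their spectrum\<close>

lemma orthonormal_carrier: "orthonormal n us \<Longrightarrow> u \<in> set us \<Longrightarrow> u \<in> carrier_vec n"
  by (auto simp: orthonormal_def)

lemma adjoint_mat_of_cols_eq_0_iff: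
  fixes us :: "complex vec list"
  assumes "set us \<subseteq> carrier_vec n" "x \<in> carrier_vec n"
  shows "mat_adjoint (mat_of_cols n us) *\<^sub>v x = 0\<^sub>v (length us) \<longleftrightarrow> (\<forall>u\<in>set us. x \<bullet>c u = 0)"
proof
  assume *: "mat_adjoint (mat_of_cols n us) *\<^sub>v x = 0\<^sub>v (length us)"
  show "\<forall>u\<in>set us. x \<bullet>c u = 0"
  proof
    fix u assume "u \<in> set us"
    then obtain i where "i < length us" "us ! i = u" by (auto simp: in_set_conv_nth)
    then show "x \<bullet>c u = 0" using adjoint_mat_of_cols_mult_vec[OF assms, of i] * by simp
  qed
next
  assume "\<forall>u\<in>set us. x \<bullet>c u = 0"
  then show "mat_adjoint (mat_of_cols n us) *\<^sub>v x = 0\<^sub>v (length us)"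
    using adjoint_mat_of_cols_mult_vec[OF assms] by (intro eq_vecI) auto
qed

text \<open>A longest orthonormal list of eigenvectors is full: otherwise the compression of
  \<open>A\<close> to the orthogonal complement has an eigenvector, which turns out to be an
  eigenvector of \<open>A\<close> itself and prolongs the list.\<close>

lemma hermitian_orthonormal_eigenbasis:
  assumes A: "A \<in> carrier_mat n n" and herm: "mat_adjoint A = A"
  obtains us d where "orthonormal n us" "length us = n"
    "\<And>i. i < n \<Longrightarrow> A *\<^sub>v us ! i = complex_of_real (d i) \<cdot>\<^sub>v us ! i"
proof -
  obtain us where us: "orthonormal n us" "\<And>u. u \<in> set us \<Longrightarrow> \<exists>e. A *\<^sub>v u = e \<cdot>\<^sub>v u"
    and max: "\<And>v. v \<in> carrier_vec n \<Longrightarrow> v \<noteq> 0\<^sub>v n \<Longrightarrow> (\<And>u. u \<in> set us \<Longrightarrow> v \<bullet>c u = 0) \<Longrightarrow>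
       (\<And>a. a \<noteq> 0 \<Longrightarrow> \<exists>e. A *\<^sub>v (a \<cdot>\<^sub>v v) = e \<cdot>\<^sub>v (a \<cdot>\<^sub>v v)) \<Longrightarrow> False"
    using maximal_orthonormal[where P = "\<lambda>u. \<exists>e. A *\<^sub>v u = e \<cdot>\<^sub>v u" and n = n] by blast
  have "length us = n"
  proof (rule ccontr)
    assume "length us \<noteq> n"
    then have less: "length us < n" using orthonormal_length[OF us(1)] by simp
    obtain ws where ws: "orthonormal n (us @ ws)" "length (us @ ws) = n"
      using orthonormal_complete[OF us(1)] by blast
    define m W where "m = length ws" and "W = mat_of_cols n ws"
    have m: "m > 0" using less ws(2) by (simp add: m_def flip: length_greater_0_conv)
    have wsc: "set ws \<subseteq> carrier_vec n" using ws by (simp add: orthonormal_def)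
    have W: "W \<in> carrier_mat n m" by (simp add: W_def m_def)
    have WW: "mat_adjoint W * W = 1\<^sub>m m"
      using orthonormal_append(2)[OF ws(1)] by (simp add: orthonormal_def W_def m_def)
    \<comment> \<open>The compression of \<open>A\<close> to the span of \<open>ws\<close>, a
      nonempty square matrix because the list \<open>us\<close> was not full.\<close>
    define B where "B = mat_adjoint W * (A * W)"
    have B: "B \<in> carrier_mat m m"
      using A mat_adjoint_carrier[OF W] W by (auto simp: B_def)
    from spectrum_non_empty[OF B m] obtain e where "eigenvalue B e"
      by (auto simp: spectrum_def)
    then obtain c where c: "c \<in> carrier_vec m" "c \<noteq> 0\<^sub>v m" "B *\<^sub>v c = e \<cdot>\<^sub>v c"
      using B by (auto simp: eigenvalue_def eigenvector_def)
    define v where "v = W *\<^sub>v c"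
    have v: "v \<in> carrier_vec n" using W c by (simp add: v_def)
    have Wv: "mat_adjoint W *\<^sub>v v = c"
      unfolding v_def using assoc_mult_mat_vec[OF mat_adjoint_carrier[OF W] W c(1)] WW c by simp
    have "v \<noteq> 0\<^sub>v n"
    proof
      assume "v = 0\<^sub>v n"
      then have "c = 0\<^sub>v m" using Wv mult_mat_zero_vec[OF mat_adjoint_carrier[OF W]] by simp
      with c show False by simp
    qed
    have vu: "v \<bullet>c u = 0" if "u \<in> set us" for u
    proof -
      have u: "u \<in> carrier_vec n" using that us(1) orthonormal_carrier by blast
      have "mat_adjoint W *\<^sub>v u = 0\<^sub>v m"
        using adjoint_mat_of_cols_eq_0_iff[OF wsc u] orthonormal_append(3)[OF ws(1) that]
        by (simp add: W_def m_def)
      then show ?thesis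
        unfolding v_def using cscalar_prod_adjoint[OF W c(1) u] c by simp
    qed
    \<comment> \<open>The residual of the eigenvalue equation. It is orthogonal to \<open>ws\<close>
      because \<open>c\<close> is an eigenvector of the compression, and to \<open>us\<close>
      because \<open>A\<close> is Hermitian and \<open>us\<close> consists of eigenvectors; hence it
      is zero.\<close>
    define z where "z = A *\<^sub>v v - e \<cdot>\<^sub>v v"
    have Av: "A *\<^sub>v v \<in> carrier_vec n" using A v by simp
    have z: "z \<in> carrier_vec n" using A v by (simp add: z_def)
    have zw: "z \<bullet>c w = 0" if "w \<in> set ws" for w
    proof -
      have "mat_adjoint W *\<^sub>v z = mat_adjoint W *\<^sub>v (A *\<^sub>v v) - e \<cdot>\<^sub>v c"
        unfolding z_def using Av v Wv mult_mat_vec[OF mat_adjoint_carrier[OF W] v]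
        by (subst mult_minus_distrib_mat_vec[OF mat_adjoint_carrier[OF W]]) auto
      also have "mat_adjoint W *\<^sub>v (A *\<^sub>v v) = B *\<^sub>v c"
      proof -
        have "A *\<^sub>v v = (A * W) *\<^sub>v c" unfolding v_def using A W c by simp
        then show ?thesis unfolding B_def
          using assoc_mult_mat_vec[OF mat_adjoint_carrier[OF W] _ c(1), of "A * W"] A W by simp
      qed
      finally have "mat_adjoint W *\<^sub>v z = 0\<^sub>v m" using c by simp
      then show ?thesis using adjoint_mat_of_cols_eq_0_iff[OF wsc z] that by (simp add: W_def m_def)
    qed
    have zu: "z \<bullet>c u = 0" if "u \<in> set us" for u
    proof -
      have u: "u \<in> carrier_vec n" using that us(1) orthonormal_carrier by blast
      obtain f where f: "A *\<^sub>v u = f \<cdot>\<^sub>v u" using us(2) \<open>u \<in> set us\<close> by blast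
      have "(A *\<^sub>v v) \<bullet>c u = v \<bullet>c (f \<cdot>\<^sub>v u)"
        using cscalar_prod_adjoint[OF A v u] herm f by simp
      then show ?thesis
        unfolding z_def using Av v u vu[OF that]
        by (simp add: minus_scalar_prod_distrib[of _ n] conjugate_smult_vec)
    qed
    have "z = 0\<^sub>v n"
      using orthonormal_full_total[OF ws z] zu zw by auto
    then have "A *\<^sub>v v = e \<cdot>\<^sub>v v"
      using minus_vec_eq_0[OF Av, of "e \<cdot>\<^sub>v v"] v by (simp add: z_def)
    then have "A *\<^sub>v (a \<cdot>\<^sub>v v) = e \<cdot>\<^sub>v (a \<cdot>\<^sub>v v)" for a
      using mult_mat_vec[OF A v, of a] by (simp add: smult_smult_assoc mult.commute)
    with max[OF v \<open>v \<noteq> 0\<^sub>v n\<close> vu] show False by blast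
  qed
  have "\<exists>e. A *\<^sub>v us ! i = complex_of_real e \<cdot>\<^sub>v us ! i" if i: "i < n" for i
  proof -
    have u: "us ! i \<in> set us" "us ! i \<in> carrier_vec n"
      using i \<open>length us = n\<close> orthonormal_carrier[OF us(1)] by auto
    obtain e where e: "A *\<^sub>v us ! i = e \<cdot>\<^sub>v us ! i" using us(2)[OF u(1)] by blast
    have 1: "us ! i \<bullet>c us ! i = 1" using us(1) i \<open>length us = n\<close> by (simp add: orthonormal_iff)
    \<comment> \<open>Moving the Hermitian matrix to the other argument shows that \<open>e\<close>
      equals its conjugate, hence is real.\<close>
    have "e = (A *\<^sub>v us ! i) \<bullet>c us ! i" using e u 1 by simp
    also have "\<dots> = us ! i \<bullet>c (e \<cdot>\<^sub>v us ! i)"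
      using cscalar_prod_adjoint[OF A u(2) u(2)] herm e by simp
    also have "\<dots> = cnj e" using u 1 by (simp add: conjugate_smult_vec)
    finally have "complex_of_real (Re e) = e" by (metis Reals_cnj_iff of_real_Re)
    with e show ?thesis by metis
  qed
  then obtain d where "\<And>i. i < n \<Longrightarrow> A *\<^sub>v us ! i = complex_of_real (d i) \<cdot>\<^sub>v us ! i" by metis
  with us(1) \<open>length us = n\<close> that show ?thesis by blast
qed

section \<open>Diagonalization, traces of powers and moments of the spectrum\<close>

lemma hermitian_diagonalization:
  assumes A: "A \<in> carrier_mat n n"
    and us: "orthonormal n us" "length us = n"
    and ev: "\<And>i. i < n \<Longrightarrow> A *\<^sub>v us ! i = d i \<cdot>\<^sub>v us ! i"
  shows "similar_mat_wit A (mat_diag n d) (mat_of_cols n us) (mat_adjoint (mat_of_cols n us))"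
proof -
  let ?U = "mat_of_cols n us"
  note U = orthonormal_full_unitary[OF us]
  have AU: "A * ?U = ?U * mat_diag n d"
  proof (rule mat_col_eqI)
    fix j assume "j < dim_col (?U * mat_diag n d)"
    then have j: "j < n" by (simp add: mat_diag_def)
    then have u: "us ! j \<in> carrier_vec n" "col ?U j = us ! j"
      using orthonormal_carrier[OF us(1)] us(2) by auto
    have "col (A * ?U) j = A *\<^sub>v us ! j" using col_mult2[OF A U(1) j] u by simp
    also have "\<dots> = col (?U * mat_diag n d) j"
      unfolding ev[OF j] mat_diag_mult_right[OF U(1)] using u j us(2)
      by (intro eq_vecI) (auto simp: mat_of_cols_index)
    finally show "col (A * ?U) j = col (?U * mat_diag n d) j" .
  qed (use A us(2) in \<open>auto simp: mat_diag_def\<close>)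
  have "A = A * (?U * mat_adjoint ?U)" using U A by simp
  also have "\<dots> = ?U * mat_diag n d * mat_adjoint ?U"
    using assoc_mult_mat[OF A U(1) mat_adjoint_carrier[OF U(1)]] AU by simp
  finally show ?thesis
    using U A by (intro similar_mat_witI[of _ _ n]) (auto simp: mat_diag_def)
qed

lemma mat_diag_pow: "mat_diag n d ^\<^sub>m h = mat_diag n (\<lambda>i. (d i :: 'a :: comm_semiring_1) ^ h)"
proof (induction h)
  case 0
  show ?case by (simp add: carrier_matD[OF mat_diag_dim])
qed (simp add: mult.commute)

lemma char_poly_mat_diag:
  "char_poly (mat_diag n d) = (\<Prod>i\<leftarrow>[0..<n]. [:- (d i :: 'a :: comm_ring_1), 1:])"
proof -
  have "upper_triangular (mat_diag n d)" by (auto simp: mat_diag_def)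
  then have "char_poly (mat_diag n d) = (\<Prod>a\<leftarrow>diag_mat (mat_diag n d). [:- a, 1:])"
    by (intro char_poly_upper_triangular[of _ n]) simp_all
  also have "diag_mat (mat_diag n d) = map d [0..<n]"
    by (auto simp: diag_mat_def mat_diag_def)
  finally show ?thesis by (simp add: o_def)
qed

lemma trace_mult_commute:
  fixes A B :: "'a :: comm_semiring_0 mat"
  assumes "A \<in> carrier_mat r c" "B \<in> carrier_mat c r"
  shows "(\<Sum>i<r. (A * B) $$ (i, i)) = (\<Sum>i<c. (B * A) $$ (i, i))"
proof -
  have "(\<Sum>i<r. (A * B) $$ (i, i)) = (\<Sum>i<r. \<Sum>j<c. A $$ (i, j) * B $$ (j, i))"
    using assms by (auto simp: scalar_prod_def lessThan_atLeast0)
  also have "\<dots> = (\<Sum>j<c. \<Sum>i<r. A $$ (i, j) * B $$ (j, i))" by (rule sum.swap)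
  also have "\<dots> = (\<Sum>i<c. (B * A) $$ (i, i))"
    using assms by (auto simp: scalar_prod_def lessThan_atLeast0 mult.commute)
  finally show ?thesis .
qed

lemma similar_mat_wit_trace:
  fixes A B :: "'a :: comm_ring_1 mat"
  assumes A: "A \<in> carrier_mat n n" and "similar_mat_wit A B P Q"
  shows "(\<Sum>i<n. A $$ (i, i)) = (\<Sum>i<n. B $$ (i, i))"
proof -
  note * = similar_mat_witD2[OF assms]
  have "(\<Sum>i<n. (P * B * Q) $$ (i, i)) = (\<Sum>i<n. (Q * (P * B)) $$ (i, i))"
    using * by (intro trace_mult_commute) auto
  also have "Q * (P * B) = B"
    by (simp only: assoc_mult_mat[OF *(7,6,5), symmetric] *(2) left_mult_one_mat[OF *(5)])
  finally show ?thesis using *(3) by simp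
qed

text \<open>The characteristic polynomial is invariant under similarity, and for the diagonal matrix
  it splits into one linear factor per index.\<close>

lemma spectrum_mset_hermitian:
  assumes A: "A \<in> carrier_mat n n"
    and us: "orthonormal n us" "length us = n"
    and ev: "\<And>i. i < n \<Longrightarrow> A *\<^sub>v us ! i = d i \<cdot>\<^sub>v us ! i"
  shows "spectrum_mset A = mset (map d [0..<n])"
proof -
  have "char_poly A = (\<Prod>i\<leftarrow>[0..<n]. [:- d i, 1:])"
    using hermitian_diagonalization[OF assms] char_poly_similar[of A "mat_diag n d"]
    by (auto simp: similar_mat_def char_poly_mat_diag)
  moreover have "proots (\<Prod>i\<leftarrow>js. [:- d i, 1:]) = mset (map d js)" for js
  proof (induction js)
    case (Cons j js)
    have "(\<Prod>i\<leftarrow>js. [:- d i, 1:]) \<noteq> 0" by (auto simp: prod_list_zero_iff)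
    then have "proots ([:- d j, 1:] * (\<Prod>i\<leftarrow>js. [:- d i, 1:])) =
        proots [:- d j, 1:] + proots (\<Prod>i\<leftarrow>js. [:- d i, 1:])"
      by (intro proots_mult) auto
    then show ?case using Cons by simp
  qed simp
  ultimately show ?thesis by (simp only: spectrum_mset_def)
qed

text \<open>The same unitary matrix that diagonalizes \<open>A\<close> diagonalizes each power, and
  similar matrices have equal trace.\<close>

lemma trace_power_hermitian:
  assumes A: "A \<in> carrier_mat n n" and herm: "mat_adjoint A = A"
  shows "(\<Sum>i<n. (A ^\<^sub>m h) $$ (i, i)) = (\<Sum>e\<in>#spectrum_mset A. e ^ h)"
proof -
  obtain us d where us: "orthonormal n us" "length us = n"
    and ev: "\<And>i. i < n \<Longrightarrow> A *\<^sub>v us ! i = complex_of_real (d i) \<cdot>\<^sub>v us ! i"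
    using hermitian_orthonormal_eigenbasis[OF assms] by blast
  let ?d = "\<lambda>i. complex_of_real (d i)"
  have "(\<Sum>i<n. (A ^\<^sub>m h) $$ (i, i)) = (\<Sum>i<n. (mat_diag n ?d ^\<^sub>m h) $$ (i, i))"
    by (rule similar_mat_wit_trace[OF pow_carrier_mat[OF A]
          similar_mat_wit_pow[OF hermitian_diagonalization[OF A us ev]]])
  also have "\<dots> = (\<Sum>i<n. complex_of_real (d i) ^ h)"
    unfolding mat_diag_pow by (simp add: mat_diag_def)
  also have "\<dots> = (\<Sum>e\<in>#spectrum_mset A. e ^ h)"
    using spectrum_mset_hermitian[OF A us ev]
    by (simp add: sum_unfold_sum_mset lessThan_atLeast0 image_mset.compositionality o_def)
  finally show ?thesis .
qed

text \<open>For each \<open>a\<close> a polynomial is chosen that vanishes at all other members of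
  both multisets but not at \<open>a\<close>. Its sum over a multiset is a combination of moments,
  with moment 0 serving the constant coefficient; it is also the count of \<open>a\<close> times a
  fixed nonzero number.\<close>

lemma mset_eq_if_moments_eq:
  fixes M N :: "complex multiset"
  assumes mom: "\<And>h. (\<Sum>e\<in>#M. e ^ h) = (\<Sum>e\<in>#N. e ^ h)"
  shows "M = N"
proof (rule multiset_eqI)
  fix a
  define S where "S = set_mset (M + N) - {a}"
  define p where "p = (\<Prod>s\<in>S. [:- s, 1:])"
  have S: "finite S" by (simp add: S_def)
  have pz: "poly p s = 0" if "s \<in> S" for s
    using that S by (simp add: p_def poly_prod prod_zero_iff)
  have pa: "poly p a \<noteq> 0"
  proof -
    have "a \<notin> S" by (simp add: S_def)
    then show ?thesis using S by (auto simp: p_def poly_prod prod_zero_iff)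
  qed
  have moment: "(\<Sum>e\<in>#K. poly p e) = (\<Sum>i\<le>degree p. coeff p i * (\<Sum>e\<in>#K. e ^ i))" for K
    by (induction K) (simp_all add: poly_altdef[of p] sum.distrib distrib_left)
  have "(\<Sum>e\<in>#K. poly p e) = of_nat (count K a) * poly p a" if "set_mset K \<subseteq> insert a S" for K
    using that by (induction K) (auto simp: distrib_right pz)
  then have "(\<Sum>e\<in>#M. poly p e) = of_nat (count M a) * poly p a"
    "(\<Sum>e\<in>#N. poly p e) = of_nat (count N a) * poly p a"
    by (auto simp: S_def)
  moreover have "(\<Sum>e\<in>#M. poly p e) = (\<Sum>e\<in>#N. poly p e)"
    unfolding moment mom ..
  ultimately have "of_nat (count M a) * poly p a = of_nat (count N a) * poly p a"
    by metis
  with pa show "count M a = count N a" by simp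
qed

section \<open>Unitary representations\<close>

lemma unitary_mat_one: "unitary_mat k (1\<^sub>m k)"
  by (simp add: unitary_mat_def)

text \<open>Unitary matrices are invertible, so landing in the general linear group is automatic and
  only multiplicativity remains.\<close>

lemma unitary_representation_iff:
  fixes G (structure)
  shows "unitary_representation G k \<pi> \<longleftrightarrow> (\<forall>g\<in>carrier G. unitary_mat k (\<pi> g)) \<and>
     (\<forall>g\<in>carrier G. \<forall>h\<in>carrier G. \<pi> (g \<otimes> h) = \<pi> g * \<pi> h)"
proof -
  have "A \<in> carrier (general_linear_group k)" if "unitary_mat k A" for A
    using that mat_adjoint_carrier[of A k k]
    by (auto simp: general_linear_group_def units_of_def Units_def ring_mat_simps unitary_mat_def)
  then show ?thesis
    unfolding unitary_representation_def representation_def hom_def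
    by (auto simp: general_linear_group_def units_of_def ring_mat_simps)
qed

text \<open>The image of the identity is idempotent; cancelling one factor by its adjoint leaves the
  identity matrix.\<close>

lemma unitary_representation_one:
  fixes G (structure)
  assumes "group G" "unitary_representation G k \<pi>"
  shows "\<pi> \<one> = 1\<^sub>m k"
proof -
  interpret group G by fact
  have u: "unitary_mat k (\<pi> \<one>)" and m: "\<pi> \<one> = \<pi> \<one> * \<pi> \<one>"
    using assms(2) unfolding unitary_representation_iff by (blast, metis one_closed r_one)
  then have c: "\<pi> \<one> \<in> carrier_mat k k" and i: "mat_adjoint (\<pi> \<one>) * \<pi> \<one> = 1\<^sub>m k"
    by (auto simp: unitary_mat_def)
  have "1\<^sub>m k = mat_adjoint (\<pi> \<one>) * (\<pi> \<one> * \<pi> \<one>)" by (simp only: i m[symmetric])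
  also have "\<dots> = \<pi> \<one>"
    using assoc_mult_mat[OF mat_adjoint_carrier[OF c] c c] i c by simp
  finally show ?thesis by simp
qed

lemma unitary_representation_inv:
  fixes G (structure)
  assumes "group G" "unitary_representation G k \<pi>" "g \<in> carrier G"
  shows "\<pi> (inv g) = mat_adjoint (\<pi> g)"
proof -
  interpret group G by fact
  have c: "\<pi> g \<in> carrier_mat k k" "\<pi> (inv g) \<in> carrier_mat k k"
    and i: "mat_adjoint (\<pi> g) * \<pi> g = 1\<^sub>m k"
    using assms by (auto simp: unitary_representation_iff unitary_mat_def)
  have "\<pi> g * \<pi> (inv g) = 1\<^sub>m k"
    using assms unitary_representation_one[OF assms(1,2)]
    by (metis inv_closed r_inv unitary_representation_iff)
  then have "mat_adjoint (\<pi> g) = mat_adjoint (\<pi> g) * (\<pi> g * \<pi> (inv g))"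
    using c by simp
  also have "\<dots> = \<pi> (inv g)"
    using assoc_mult_mat[OF mat_adjoint_carrier[OF c(1)] c] i c by simp
  finally show ?thesis by simp
qed

text \<open>As the columns of \<open>V\<close> are orthonormal, \<open>V * mat_adjoint V\<close> is
  the orthogonal projection onto their span. The hypothesis \<open>inv\<close> thus says that this
  span is invariant, and the result is the restriction of the representation to it, in the
  coordinates given by \<open>V\<close>.\<close>

lemma subrepresentation:
  fixes G (structure)
  assumes G: "group G" and \<pi>: "unitary_representation G k \<pi>"
    and V: "V \<in> carrier_mat k m" "mat_adjoint V * V = 1\<^sub>m m"
    and inv: "\<And>g. g \<in> carrier G \<Longrightarrow> V * (mat_adjoint V * (\<pi> g * V)) = \<pi> g * V"
  shows "unitary_representation G m (\<lambda>g. mat_adjoint V * (\<pi> g * V))"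
proof -
  interpret group G by fact
  let ?\<rho> = "\<lambda>g. mat_adjoint V * (\<pi> g * V)"
  note Va = mat_adjoint_carrier[OF V(1)]
  have c: "\<pi> g \<in> carrier_mat k k" if "g \<in> carrier G" for g
    using \<pi> that by (auto simp: unitary_representation_iff unitary_mat_def)
  have cV: "\<pi> g * V \<in> carrier_mat k m" if "g \<in> carrier G" for g
    using c[OF that] V(1) by simp
  have \<rho>c: "?\<rho> g \<in> carrier_mat m m" if "g \<in> carrier G" for g
    using cV[OF that] Va by simp
  have mult: "?\<rho> (g \<otimes> h) = ?\<rho> g * ?\<rho> h" if g: "g \<in> carrier G" and h: "h \<in> carrier G" for g h
  proof -
    have "?\<rho> g * ?\<rho> h = mat_adjoint V * (\<pi> g * V * ?\<rho> h)"
      by (rule assoc_mult_mat[OF Va cV[OF g] \<rho>c[OF h]])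
    also have "\<pi> g * V * ?\<rho> h = \<pi> g * (V * ?\<rho> h)"
      by (rule assoc_mult_mat[OF c[OF g] V(1) \<rho>c[OF h]])
    also have "\<dots> = \<pi> g * \<pi> h * V"
      unfolding inv[OF h] by (rule assoc_mult_mat[OF c[OF g] c[OF h] V(1), symmetric])
    also have "\<pi> g * \<pi> h = \<pi> (g \<otimes> h)"
      using \<pi> g h by (simp add: unitary_representation_iff)
    finally show ?thesis by simp
  qed
  \<comment> \<open>The adjoint of a compression is the compression at the inverse element, so
    unitarity follows from \<open>mult\<close> and \<open>one\<close>.\<close>
  have adj: "mat_adjoint (?\<rho> g) = ?\<rho> (inv g)" if g: "g \<in> carrier G" for g
  proof -
    have "mat_adjoint (?\<rho> g) = mat_adjoint V * mat_adjoint (\<pi> g) * V"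
      using mat_adjoint_mult[OF Va cV[OF g]] mat_adjoint_mult[OF c[OF g] V(1)] by simp
    also have "\<dots> = mat_adjoint V * (\<pi> (inv g) * V)"
      unfolding unitary_representation_inv[OF G \<pi> g]
      by (rule assoc_mult_mat[OF Va mat_adjoint_carrier[OF c[OF g]] V(1)])
    finally show ?thesis .
  qed
  have one: "?\<rho> \<one> = 1\<^sub>m m"
    using unitary_representation_one[OF G \<pi>] V by simp
  have "unitary_mat m (?\<rho> g)" if g: "g \<in> carrier G" for g
    unfolding unitary_mat_def adj[OF g]
    using \<rho>c[OF g] mult[OF g inv_closed[OF g], symmetric] mult[OF inv_closed[OF g] g, symmetric]
      one g by simp
  with mult show ?thesis by (simp add: unitary_representation_iff)
qed

section \<open>Subspaces, orthogonal projections and adapted bases\<close>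

lemma subspace_closed:
  assumes "VectorSpace.subspace class_ring W (module_vec TYPE(complex) k)"
  shows "W \<subseteq> carrier_vec k" "0\<^sub>v k \<in> W"
    and "\<And>v w. v \<in> W \<Longrightarrow> w \<in> W \<Longrightarrow> v + w \<in> W"
    and "\<And>a v. v \<in> W \<Longrightarrow> a \<cdot>\<^sub>v v \<in> W"
  using assms
  by (auto simp: VectorSpace.subspace_def submodule_def module_vec_simps class_ring_simps)

text \<open>Here \<open>y\<close> is the projection of \<open>x\<close> onto the span of
  \<open>us\<close>. The span is not named: its double orthogonal complement stands in for it in the
  last property.\<close>

lemma subspace_orthogonal_projection:
  assumes W: "VectorSpace.subspace class_ring W (module_vec TYPE(complex) k)"
    and us: "orthonormal k us" "set us \<subseteq> W" and x: "x \<in> carrier_vec k"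
  obtains y where "y \<in> W" "\<And>u. u \<in> set us \<Longrightarrow> (x - y) \<bullet>c u = 0"
    "\<And>w. w \<in> carrier_vec k \<Longrightarrow> (\<And>u. u \<in> set us \<Longrightarrow> u \<bullet>c w = 0) \<Longrightarrow> y \<bullet>c w = 0"
proof -
  note Wc = subspace_closed[OF W]
  have "\<exists>y\<in>W. (\<forall>u\<in>set us. (x - y) \<bullet>c u = 0) \<and>
      (\<forall>w\<in>carrier_vec k. (\<forall>u\<in>set us. u \<bullet>c w = 0) \<longrightarrow> y \<bullet>c w = 0)"
    using us
  proof (induction us rule: rev_induct)
    case Nil
    show ?case using Wc(2) by (intro bexI[of _ "0\<^sub>v k"]) auto
  next
    case (snoc u us)
    then obtain y where y: "y \<in> W" "\<forall>u\<in>set us. (x - y) \<bullet>c u = 0"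
      "\<forall>w\<in>carrier_vec k. (\<forall>u\<in>set us. u \<bullet>c w = 0) \<longrightarrow> y \<bullet>c w = 0"
      using orthonormal_append(1)[of k us "[u]"] by auto
    have u: "u \<in> W" "u \<in> carrier_vec k"
      using snoc.prems orthonormal_carrier[of k "us @ [u]" u] by auto
    have "(us @ [u]) ! length us \<bullet>c (us @ [u]) ! length us = 1"
      using snoc.prems(1) unfolding orthonormal_iff by (metis length_append_singleton lessI)
    then have uu: "u \<bullet>c u = 1" by simp
    have yc: "y \<in> carrier_vec k" using y Wc by auto
    \<comment> \<open>The Fourier coefficient that makes the new error orthogonal to
      \<open>u\<close>, since \<open>u\<close> has norm 1; the earlier members of the list are
      orthogonal to \<open>u\<close> and stay unaffected.\<close>
    define a where "a = (x - y) \<bullet>c u"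
    have *: "x - (y + a \<cdot>\<^sub>v u) = (x - y) - a \<cdot>\<^sub>v u"
      using x yc u(2) by (intro eq_vecI) auto
    have "(x - (y + a \<cdot>\<^sub>v u)) \<bullet>c v = 0" if "v \<in> set (us @ [u])" for v
    proof -
      have v: "v \<in> carrier_vec k" using that snoc.prems(1) orthonormal_carrier by blast
      have eq: "(x - (y + a \<cdot>\<^sub>v u)) \<bullet>c v = (x - y) \<bullet>c v - a * (u \<bullet>c v)"
        unfolding * using x yc u v by (simp add: minus_scalar_prod_distrib[of _ k])
      show ?thesis
      proof (cases "v = u")
        case True
        then show ?thesis using eq uu a_def by simp
      next
        case False
        then have "v \<in> set us" using that by simp
        moreover have "v \<bullet>c u = 0"
          using orthonormal_append(3)[OF snoc.prems(1) \<open>v \<in> set us\<close>] by simp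
        then have "u \<bullet>c v = 0" using cscalar_prod_commute[OF u(2) v] by simp
        ultimately show ?thesis using eq y by simp
      qed
    qed
    moreover have "(y + a \<cdot>\<^sub>v u) \<bullet>c w = 0"
      if "w \<in> carrier_vec k" "\<forall>v\<in>set (us @ [u]). v \<bullet>c w = 0" for w
    proof -
      have "y \<bullet>c w = 0" "u \<bullet>c w = 0" using that y(3) by auto
      then show ?thesis using that(1) yc u by (simp add: add_scalar_prod_distrib[of _ k])
    qed
    moreover have "y + a \<cdot>\<^sub>v u \<in> W" using Wc y u by auto
    ultimately show ?case by blast
  qed
  with that show ?thesis by blast
qed

text \<open>\<open>us\<close> is a longest orthonormal list in \<open>W\<close>, so it spans
  \<open>W\<close>, and \<open>ws\<close> spans the orthogonal complement. Both are nonempty because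
  \<open>W\<close> is proper and nonzero; this is what makes both subrepresentations strictly
  smaller.\<close>

lemma subspace_adapted_basis:
  assumes W: "VectorSpace.subspace class_ring W (module_vec TYPE(complex) k)"
    and ne: "W \<noteq> {0\<^sub>v k}" "W \<noteq> carrier_vec k"
  obtains us ws where "orthonormal k (us @ ws)" "length (us @ ws) = k" "us \<noteq> []" "ws \<noteq> []"
    "set us \<subseteq> W" "\<And>x w. x \<in> W \<Longrightarrow> w \<in> set ws \<Longrightarrow> x \<bullet>c w = 0"
proof -
  note Wc = subspace_closed[OF W]
  obtain us where us: "orthonormal k us" "\<And>u. u \<in> set us \<Longrightarrow> u \<in> W"
    and max: "\<And>v. v \<in> carrier_vec k \<Longrightarrow> v \<noteq> 0\<^sub>v k \<Longrightarrow> (\<And>u. u \<in> set us \<Longrightarrow> v \<bullet>c u = 0) \<Longrightarrow>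
       (\<And>a. a \<noteq> 0 \<Longrightarrow> a \<cdot>\<^sub>v v \<in> W) \<Longrightarrow> False"
    using maximal_orthonormal[where P = "\<lambda>u. u \<in> W" and n = k] by blast
  obtain ws where ws: "orthonormal k (us @ ws)" "length (us @ ws) = k"
    using orthonormal_complete[OF us(1)] by blast
  have usW: "set us \<subseteq> W" using us by auto
  have orth: "x \<bullet>c w = 0" if x: "x \<in> W" and w: "w \<in> set ws" for x w
  proof -
    have xc: "x \<in> carrier_vec k" using x Wc by auto
    obtain y where y: "y \<in> W" "\<And>u. u \<in> set us \<Longrightarrow> (x - y) \<bullet>c u = 0"
      "\<And>w. w \<in> carrier_vec k \<Longrightarrow> (\<And>u. u \<in> set us \<Longrightarrow> u \<bullet>c w = 0) \<Longrightarrow> y \<bullet>c w = 0"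
      using subspace_orthogonal_projection[OF W us(1) usW xc] by blast
    have yc: "y \<in> carrier_vec k" using y Wc by auto
    \<comment> \<open>The difference of \<open>x\<close> and its projection lies in \<open>W\<close>
      and is orthogonal to \<open>us\<close>, so maximality makes it zero.\<close>
    have "x - y = x + (- 1) \<cdot>\<^sub>v y" using xc yc by (intro eq_vecI) auto
    then have "x - y \<in> W" using Wc x y by auto
    then have "x - y = 0\<^sub>v k" using max[of "x - y"] y(2) Wc xc yc by auto
    then have "x = y" using minus_vec_eq_0[OF xc yc] by simp
    moreover have "w \<in> carrier_vec k" using orthonormal_carrier[OF ws(1)] w by auto
    ultimately show ?thesis using y(3) orthonormal_append(3)[OF ws(1) _ w] by auto
  qed
  have "us \<noteq> []"
  proof
    assume "us = []"
    obtain x where x: "x \<in> W" "x \<noteq> 0\<^sub>v k" using ne(1) Wc(2) by auto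
    with Wc max[of x] \<open>us = []\<close> show False by auto
  qed
  moreover have "ws \<noteq> []"
  proof
    assume "ws = []"
    have "x \<in> W" if x: "x \<in> carrier_vec k" for x
    proof -
      obtain y where y: "y \<in> W" "\<And>u. u \<in> set us \<Longrightarrow> (x - y) \<bullet>c u = 0"
        "\<And>w. w \<in> carrier_vec k \<Longrightarrow> (\<And>u. u \<in> set us \<Longrightarrow> u \<bullet>c w = 0) \<Longrightarrow> y \<bullet>c w = 0"
        using subspace_orthogonal_projection[OF W us(1) usW x] by blast
      have "x - y = 0\<^sub>v k"
        using orthonormal_full_total[OF us(1) _ _ y(2)] ws(2) \<open>ws = []\<close> x y(1) Wc(1) by auto
      then show ?thesis using minus_vec_eq_0[OF x] y(1) Wc(1) by auto
    qed
    with ne(2) Wc(1) show False by auto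
  qed
  ultimately show ?thesis using that ws usW orth by blast
qed

text \<open>Turns invariance stated by inner products into the matrix identity that
  \<open>subrepresentation\<close> expects: the error of the projection is orthogonal to
  \<open>us\<close> by construction and to \<open>ws\<close> by \<open>inv\<close>. Totality is a
  statement about the union of both sets, so \<open>us\<close> and \<open>ws\<close> can be
  exchanged and the complement is covered too.\<close>

lemma invariant_columns:
  assumes us: "orthonormal k us" and ws: "set ws \<subseteq> carrier_vec k"
    and orth: "\<And>u w. u \<in> set us \<Longrightarrow> w \<in> set ws \<Longrightarrow> u \<bullet>c w = 0"
    and total: "\<And>x. x \<in> carrier_vec k \<Longrightarrow> (\<And>u. u \<in> set us \<union> set ws \<Longrightarrow> x \<bullet>c u = 0) \<Longrightarrow> x = 0\<^sub>v k"
    and M: "M \<in> carrier_mat k k"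
    and inv: "\<And>u w. u \<in> set us \<Longrightarrow> w \<in> set ws \<Longrightarrow> (M *\<^sub>v u) \<bullet>c w = 0"
  defines "V \<equiv> mat_of_cols k us"
  shows "V * (mat_adjoint V * (M * V)) = M * V"
proof (rule mat_col_eqI)
  have V: "V \<in> carrier_mat k (length us)" by (simp add: V_def)
  note Va = mat_adjoint_carrier[OF V]
  show "dim_row (V * (mat_adjoint V * (M * V))) = dim_row (M * V)"
    "dim_col (V * (mat_adjoint V * (M * V))) = dim_col (M * V)" using V M by auto
  fix j assume "j < dim_col (M * V)"
  then have j: "j < length us" using V by simp
  have MV: "M * V \<in> carrier_mat k (length us)" using M V by simp
  have usc: "set us \<subseteq> carrier_vec k" using us by (simp add: orthonormal_def)
  have uj: "us ! j \<in> carrier_vec k" "us ! j \<in> set us" using usc j by auto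
  have colV: "col V j = us ! j" using uj j by (simp add: V_def)
  define z where "z = M *\<^sub>v us ! j"
  have z: "z \<in> carrier_vec k" using M uj by (simp add: z_def)
  define c where "c = mat_adjoint V *\<^sub>v z"
  have c: "c \<in> carrier_vec (length us)" using Va z by (simp add: c_def)
  have Vc: "V *\<^sub>v c \<in> carrier_vec k" using V c by simp
  have colM: "col (M * V) j = z" unfolding z_def using col_mult2[OF M V j] colV by simp
  have colL: "col (V * (mat_adjoint V * (M * V))) j = V *\<^sub>v c"
    using col_mult2[OF V _ j, of "mat_adjoint V * (M * V)"] col_mult2[OF Va MV j] colM Va MV
    by (simp add: c_def)
  have "z - V *\<^sub>v c = 0\<^sub>v k"
  proof (rule total)
    show "z - V *\<^sub>v c \<in> carrier_vec k" using z Vc by simp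
    fix u assume "u \<in> set us \<union> set ws"
    then show "(z - V *\<^sub>v c) \<bullet>c u = 0"
    proof
      assume u: "u \<in> set us"
      have "mat_adjoint V *\<^sub>v (V *\<^sub>v c) = c"
        using assoc_mult_mat_vec[OF Va V c] us c by (simp add: orthonormal_def V_def)
      then have "mat_adjoint V *\<^sub>v (z - V *\<^sub>v c) = 0\<^sub>v (length us)"
        using mult_minus_distrib_mat_vec[OF Va z Vc] c by (simp add: c_def)
      then show ?thesis
        using adjoint_mat_of_cols_eq_0_iff[OF usc, of "z - V *\<^sub>v c"] z Vc u by (simp add: V_def)
    next
      assume w: "u \<in> set ws"
      then have uc: "u \<in> carrier_vec k" using ws by auto
      have "u \<bullet>c v = 0" if "v \<in> set us" for v
        using cscalar_prod_commute[OF uc, of v] orth[OF that w] usc that by auto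
      then have "mat_adjoint V *\<^sub>v u = 0\<^sub>v (length us)"
        using adjoint_mat_of_cols_eq_0_iff[OF usc uc] by (simp add: V_def)
      then have "(V *\<^sub>v c) \<bullet>c u = 0" using cscalar_prod_adjoint[OF V c uc] c by simp
      then show ?thesis
        using inv[OF uj(2) w] minus_scalar_prod_distrib[OF z Vc, of "conjugate u"] uc
        by (simp add: z_def)
    qed
  qed
  then show "col (V * (mat_adjoint V * (M * V))) j = col (M * V) j"
    using minus_vec_eq_0[OF z Vc] colL colM by simp
qed

section \<open>The regular representation and the separation of group elements\<close>

definition regular_representation ::
  "('g, 'm) monoid_scheme \<Rightarrow> (nat \<Rightarrow> 'g) \<Rightarrow> nat \<Rightarrow> 'g \<Rightarrow> complex mat" where
  "regular_representation G e n g =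
     mat n n (\<lambda>(i, j). if e i = g \<otimes>\<^bsub>G\<^esub> e j then 1 else 0)"

text \<open>The matrices are permutation matrices of left translations, so the adjoint belongs to
  the inverse. Faithfulness is read off the diagonal entry at the index of the identity.\<close>

lemma regular_representation:
  fixes G (structure)
  assumes "group G" and e: "bij_betw e {..<n} (carrier G)"
  shows "unitary_representation G n (regular_representation G e n)"
    and "g \<in> carrier G \<Longrightarrow> regular_representation G e n g = 1\<^sub>m n \<Longrightarrow> g = \<one>"
proof -
  interpret group G by fact
  let ?R = "regular_representation G e n"
  have ec: "e i \<in> carrier G" if "i < n" for i
    using e that by (auto simp: bij_betw_def)
  have inj: "e i = e j \<longleftrightarrow> i = j" if "i < n" "j < n" for i j
    using e that by (auto simp: bij_betw_def inj_on_def)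
  have sur: "\<exists>i<n. e i = x" if "x \<in> carrier G" for x
    using e that by (metis bij_betw_def imageE lessThan_iff)
  have c: "?R g \<in> carrier_mat n n" for g by (simp add: regular_representation_def)
  have mult: "?R (g \<otimes> h) = ?R g * ?R h" if g: "g \<in> carrier G" and h: "h \<in> carrier G" for g h
  proof (rule eq_matI)
    fix i j assume "i < dim_row (?R g * ?R h)" "j < dim_col (?R g * ?R h)"
    then have ij: "i < n" "j < n" using c[of g] c[of h] by auto
    \<comment> \<open>The only index at which the second factor has a nonzero entry in column
      \<open>j\<close>.\<close>
    obtain l where l: "l < n" "e l = h \<otimes> e j" using sur[of "h \<otimes> e j"] h ec[OF ij(2)] by auto
    have "(?R g * ?R h) $$ (i, j) = (\<Sum>m<n. ?R g $$ (i, m) * ?R h $$ (m, j))"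
      using ij c[of g] c[of h] by (simp add: scalar_prod_def lessThan_atLeast0)
    also have "\<dots> = (\<Sum>m<n. if m = l then (if e i = g \<otimes> e l then 1 else 0) else 0)"
      using ij l inj[OF _ l(1)]
      by (intro sum.cong) (auto simp: regular_representation_def simp flip: l(2))
    also have "\<dots> = (if e i = g \<otimes> e l then 1 else 0)" using l by simp
    also have "\<dots> = ?R (g \<otimes> h) $$ (i, j)"
      using ij l g h ec[OF ij(2)] by (simp add: regular_representation_def m_assoc)
    finally show "?R (g \<otimes> h) $$ (i, j) = (?R g * ?R h) $$ (i, j)" by simp
  qed (simp_all add: regular_representation_def)
  have one: "?R \<one> = 1\<^sub>m n"
    using inj ec by (intro eq_matI) (auto simp: regular_representation_def)
  have adj: "mat_adjoint (?R g) = ?R (inv g)" if g: "g \<in> carrier G" for g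
  proof (rule eq_matI)
    fix i j assume "i < dim_row (?R (inv g))" "j < dim_col (?R (inv g))"
    then have ij: "i < n" "j < n" using c[of "inv g"] by auto
    have "e j = g \<otimes> e i \<longleftrightarrow> e i = inv g \<otimes> e j"
      using g ec[OF ij(1)] ec[OF ij(2)] by (metis inv_solve_left)
    then show "mat_adjoint (?R g) $$ (i, j) = ?R (inv g) $$ (i, j)"
      using ij by (simp add: regular_representation_def)
  qed (simp_all add: regular_representation_def)
  have "unitary_mat n (?R g)" if g: "g \<in> carrier G" for g
    unfolding unitary_mat_def adj[OF g]
    using c[of g] mult[OF g inv_closed[OF g], symmetric] mult[OF inv_closed[OF g] g, symmetric]
      one g by simp
  with mult show "unitary_representation G n ?R" by (simp add: unitary_representation_iff)
  show "g = \<one>" if g: "g \<in> carrier G" and "?R g = 1\<^sub>m n"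
  proof -
    obtain i where i: "i < n" "e i = \<one>" using sur[of \<one>] by auto
    have "?R g $$ (i, i) = 1" using that i by simp
    then have "e i = g \<otimes> e i" using i by (simp add: regular_representation_def split: if_splits)
    then show ?thesis using i g by simp
  qed
qed

text \<open>A unitary representation of least degree among those in which \<open>g\<close> acts nontrivially is
  irreducible: on an invariant subspace or on its orthogonal complement \<open>g\<close> would still act
  nontrivially.\<close>

lemma exists_irreducible_nontrivial:
  fixes G (structure)
  assumes G: "group G" and "finite (carrier G)" and g: "g \<in> carrier G" "g \<noteq> \<one>"
  obtains k \<pi> where "unitary_representation G k \<pi>" "irreducible_representation G k \<pi>"
    "\<pi> g \<noteq> 1\<^sub>m k"
proof -
  let ?P = "\<lambda>k. \<exists>\<pi>. unitary_representation G k \<pi> \<and> \<pi> g \<noteq> 1\<^sub>m k"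
  obtain e where e: "bij_betw e {..<card (carrier G)} (carrier G)"
    using ex_bij_betw_nat_finite[OF assms(2)] by (auto simp: lessThan_atLeast0)
  \<comment> \<open>The regular representation is a candidate, being faithful.\<close>
  have "\<exists>k. ?P k" using regular_representation[OF G e] g by metis
  define k where "k = (LEAST k. ?P k)"
  have "?P k" unfolding k_def by (rule LeastI_ex) fact
  then obtain \<pi> where \<pi>: "unitary_representation G k \<pi>" "\<pi> g \<noteq> 1\<^sub>m k" by blast
  have least: "\<rho> g = 1\<^sub>m m" if "unitary_representation G m \<rho>" "m < k" for m \<rho>
    using that not_less_Least[of m ?P] unfolding k_def by auto
  have \<pi>c: "\<pi> h \<in> carrier_mat k k" if "h \<in> carrier G" for h
    using \<pi>(1) that by (simp add: unitary_representation_iff unitary_mat_def)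
  have "k > 0"
  proof (rule ccontr)
    assume "\<not> k > 0"
    then have "\<pi> g = 1\<^sub>m k" using \<pi>c[OF g(1)] by (intro eq_matI) auto
    with \<pi>(2) show False by simp
  qed
  moreover have "W = {0\<^sub>v k} \<or> W = carrier_vec k"
    if W: "VectorSpace.subspace class_ring W (module_vec TYPE(complex) k)"
      and Winv: "\<forall>h\<in>carrier G. \<forall>w\<in>W. \<pi> h *\<^sub>v w \<in> W" for W
  proof (rule ccontr)
    assume "\<not> (W = {0\<^sub>v k} \<or> W = carrier_vec k)"
    then obtain us ws where uw: "orthonormal k (us @ ws)" "length (us @ ws) = k"
      and ne: "us \<noteq> []" "ws \<noteq> []" and usW: "set us \<subseteq> W"
      and orthW: "\<And>x w. x \<in> W \<Longrightarrow> w \<in> set ws \<Longrightarrow> x \<bullet>c w = 0"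
      using subspace_adapted_basis[OF W] by metis
    have usc: "set us \<subseteq> carrier_vec k" and wsc: "set ws \<subseteq> carrier_vec k"
      using uw(1) by (auto simp: orthonormal_def)
    have orth: "u \<bullet>c w = 0" "w \<bullet>c u = 0" if "u \<in> set us" "w \<in> set ws" for u w
    proof -
      show "u \<bullet>c w = 0" using orthW usW that by auto
      then show "w \<bullet>c u = 0"
        using cscalar_prod_commute[of w k u] usc wsc that by auto
    qed
    have total: "x = 0\<^sub>v k"
      if "x \<in> carrier_vec k" "\<And>u. u \<in> set us \<union> set ws \<Longrightarrow> x \<bullet>c u = 0" for x
      using orthonormal_full_total[OF uw that(1)] that(2) by auto
    \<comment> \<open>The compression to the span of a shorter list has degree below
      \<open>k\<close>, so by minimality \<open>g\<close> acts trivially in it; invariance of the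
      span lifts this to the columns themselves.\<close>
    have fixes_columns: "\<pi> g *\<^sub>v v = v"
      if vs: "orthonormal k vs" "length vs < k" and v: "v \<in> set vs"
        and inv: "\<And>h. h \<in> carrier G \<Longrightarrow> mat_of_cols k vs * (mat_adjoint (mat_of_cols k vs) *
            (\<pi> h * mat_of_cols k vs)) = \<pi> h * mat_of_cols k vs" for v vs
    proof -
      let ?V = "mat_of_cols k vs"
      have V: "?V \<in> carrier_mat k (length vs)" by simp
      have VV: "mat_adjoint ?V * ?V = 1\<^sub>m (length vs)" using vs by (simp add: orthonormal_def)
      have "mat_adjoint ?V * (\<pi> g * ?V) = 1\<^sub>m (length vs)"
        using least[OF subrepresentation[OF G \<pi>(1) V VV inv] vs(2)] .
      then have *: "\<pi> g * ?V = ?V" using inv[OF g(1)] V by simp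
      obtain j where j: "j < length vs" "vs ! j = v" using v by (auto simp: in_set_conv_nth)
      have "col ?V j = v" using j orthonormal_carrier[OF vs(1) v] by simp
      then show ?thesis using col_mult2[OF \<pi>c[OF g(1)] V j(1)] * by simp
    qed
    have "\<pi> g *\<^sub>v u = u" if "u \<in> set us" for u
    proof (rule fixes_columns[OF orthonormal_append(1)[OF uw(1)] _ that])
      show "length us < k" using uw(2) ne(2) by (cases ws) auto
      fix h assume h: "h \<in> carrier G"
      show "mat_of_cols k us * (mat_adjoint (mat_of_cols k us) * (\<pi> h * mat_of_cols k us)) =
          \<pi> h * mat_of_cols k us"
        using Winv h usW orthW
        by (intro invariant_columns[OF orthonormal_append(1)[OF uw(1)] wsc orth(1) total \<pi>c[OF h]])
          auto
    qed
    moreover have "\<pi> g *\<^sub>v w = w" if "w \<in> set ws" for w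
    proof (rule fixes_columns[OF orthonormal_append(2)[OF uw(1)] _ that])
      show "length ws < k" using uw(2) ne(1) by (cases us) auto
      fix h assume h: "h \<in> carrier G"
      \<comment> \<open>The complement of \<open>W\<close> is invariant since the adjoint of
        \<open>\<pi> h\<close> is the matrix of \<open>inv h\<close>, which preserves
        \<open>W\<close>.\<close>
      have "(\<pi> h *\<^sub>v w) \<bullet>c u = 0" if "w \<in> set ws" "u \<in> set us" for w u
      proof -
        have "inv h \<in> carrier G" using G h by (simp add: group.inv_closed)
        then have "\<pi> (inv h) *\<^sub>v u \<in> W" using Winv usW that(2) by auto
        then have *: "mat_adjoint (\<pi> h) *\<^sub>v u \<in> W"
          using unitary_representation_inv[OF G \<pi>(1) h] by simp
        then have "(mat_adjoint (\<pi> h) *\<^sub>v u) \<bullet>c w = 0" using orthW that by blast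
        moreover have "mat_adjoint (\<pi> h) *\<^sub>v u \<in> carrier_vec k"
          using * subspace_closed(1)[OF W] by auto
        ultimately show ?thesis
          using cscalar_prod_adjoint[OF \<pi>c[OF h], of w u] cscalar_prod_commute[of w k] that usc wsc
          by (metis complex_cnj_zero subsetD)
      qed
      then show "mat_of_cols k ws * (mat_adjoint (mat_of_cols k ws) * (\<pi> h * mat_of_cols k ws)) =
          \<pi> h * mat_of_cols k ws"
        using orth total[unfolded Un_commute[of "set us"]]
        by (intro invariant_columns[OF orthonormal_append(2)[OF uw(1)] usc _ _ \<pi>c[OF h]]) blast+
    qed
    ultimately have fix_all: "\<pi> g *\<^sub>v v = v" if "v \<in> set (us @ ws)" for v using that by auto
    let ?U = "mat_of_cols k (us @ ws)"
    note U = orthonormal_full_unitary[OF uw]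
    \<comment> \<open>\<open>\<pi> g\<close> fixes a full orthonormal list, whose matrix is
      invertible; so it is the identity, against the choice of \<open>\<pi>\<close>.\<close>
    have "\<pi> g * ?U = ?U"
    proof (rule mat_col_eqI)
      fix j assume "j < dim_col ?U"
      then have j: "j < k" using uw(2) by simp
      have v: "(us @ ws) ! j \<in> set (us @ ws)" using j uw(2) by (metis nth_mem)
      have "col ?U j = (us @ ws) ! j"
        using j uw(2) orthonormal_carrier[OF uw(1) v] by (intro col_mat_of_cols) auto
      then show "col (\<pi> g * ?U) j = col ?U j"
        using col_mult2[OF \<pi>c[OF g(1)] U(1) j] fix_all[OF v] by simp
    qed (use \<pi>c[OF g(1)] in auto)
    then have "\<pi> g * (?U * mat_adjoint ?U) = ?U * mat_adjoint ?U"
      using assoc_mult_mat[OF \<pi>c[OF g(1)] U(1) mat_adjoint_carrier[OF U(1)]] by simp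
    then have "\<pi> g = 1\<^sub>m k" using U(3) \<pi>c[OF g(1)] by simp
    with \<pi>(2) show False by simp
  qed
  ultimately have "irreducible_representation G k \<pi>"
    using \<pi>(1) by (auto simp: irreducible_representation_def unitary_representation_def)
  with \<pi> that show ?thesis by blast
qed

section \<open>Closed walks and traces of powers\<close>

lemma unitary_column_norm:
  assumes "unitary_mat k U" "j < k"
  shows "(\<Sum>i<k. (cmod (U $$ (i, j)))\<^sup>2) = 1"
proof -
  have U: "U \<in> carrier_mat k k" "mat_adjoint U * U = 1\<^sub>m k" using assms by (auto simp: unitary_mat_def)
  have "complex_of_real (\<Sum>i<k. (cmod (U $$ (i, j)))\<^sup>2) = (\<Sum>i<k. cnj (U $$ (i, j)) * U $$ (i, j))"
    by (simp add: complex_norm_square mult.commute flip: of_real_power)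
  also have "\<dots> = (mat_adjoint U * U) $$ (j, j)"
    using U(1) assms(2) by (simp add: scalar_prod_def lessThan_atLeast0)
  also have "\<dots> = 1" using U assms(2) by simp
  finally show ?thesis using of_real_eq_1_iff by blast
qed

lemma unitary_diag_Re_le:
  assumes "unitary_mat k U" "j < k"
  shows "Re (U $$ (j, j)) \<le> 1"
proof -
  have "(cmod (U $$ (j, j)))\<^sup>2 \<le> (\<Sum>i<k. (cmod (U $$ (i, j)))\<^sup>2)"
    using assms(2) by (intro member_le_sum) auto
  then have "cmod (U $$ (j, j)) \<le> 1" using unitary_column_norm[OF assms] by (simp add: power_le_one_iff)
  then show ?thesis using complex_Re_le_cmod order_trans by blast
qed

lemma unitary_trace_le:
  assumes "unitary_mat k U" shows "Re (\<Sum>j<k. U $$ (j, j)) \<le> k"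
proof -
  have "(\<Sum>j<k. Re (U $$ (j, j))) \<le> (\<Sum>j<k. 1)"
    using unitary_diag_Re_le[OF assms] by (intro sum_mono) auto
  then show ?thesis by simp
qed

text \<open>Equality forces every diagonal entry to have real part 1. Its column has norm 1, which
  leaves no room for an imaginary part or for entries off the diagonal.\<close>

lemma unitary_trace_eq_imp_one:
  assumes U: "unitary_mat k U" and tr: "Re (\<Sum>j<k. U $$ (j, j)) = k"
  shows "U = 1\<^sub>m k"
proof (rule eq_matI)
  have "(\<Sum>j<k. 1 - Re (U $$ (j, j))) = 0" using tr by (simp add: sum_subtractf)
  then have re: "Re (U $$ (j, j)) = 1" if "j < k" for j
    using sum_nonneg_eq_0_iff[of "{..<k}" "\<lambda>j. 1 - Re (U $$ (j, j))"] unitary_diag_Re_le[OF U] that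
    by auto
  fix i j assume "i < dim_row (1\<^sub>m k :: complex mat)" "j < dim_col (1\<^sub>m k :: complex mat)"
  then have ij: "i < k" "j < k" by auto
  have "(\<Sum>i<k. (cmod (U $$ (i, j)))\<^sup>2) =
      (cmod (U $$ (j, j)))\<^sup>2 + (\<Sum>i\<in>{..<k} - {j}. (cmod (U $$ (i, j)))\<^sup>2)"
    using ij by (intro sum.remove) auto
  moreover have "(cmod (U $$ (j, j)))\<^sup>2 = 1 + (Im (U $$ (j, j)))\<^sup>2"
    using re[OF ij(2)] by (simp add: cmod_power2)
  moreover have "(\<Sum>i\<in>{..<k} - {j}. (cmod (U $$ (i, j)))\<^sup>2) \<ge> 0" by (intro sum_nonneg) auto
  ultimately have "(Im (U $$ (j, j)))\<^sup>2 = 0" "(\<Sum>i\<in>{..<k} - {j}. (cmod (U $$ (i, j)))\<^sup>2) = 0"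
    using unitary_column_norm[OF U ij(2)] zero_le_power2[of "Im (U $$ (j, j))"] by linarith+
  then show "U $$ (i, j) = 1\<^sub>m k $$ (i, j)"
    using re[OF ij(2)] ij by (auto simp: sum_nonneg_eq_0_iff complex_eq_iff)
qed (use U in \<open>auto simp: unitary_mat_def\<close>)

text \<open>Matrix powers grow on the right, while walks are lists that grow at the head; the
  induction over walks needs the new factor on the left.\<close>

lemma pow_mat_Suc_left:
  assumes "A \<in> carrier_mat n n"
  shows "A ^\<^sub>m Suc h = A * A ^\<^sub>m h"
proof (induction h)
  case 0
  show ?case using assms by simp
next
  case (Suc h)
  have "A ^\<^sub>m Suc (Suc h) = A * A ^\<^sub>m h * A" using Suc by simp
  also have "\<dots> = A * A ^\<^sub>m Suc h"
    using assoc_mult_mat[OF assms pow_carrier_mat[OF assms] assms] by simp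
  finally show ?case .
qed

lemma block_index:
  fixes i r n k :: nat
  assumes "i < n" "r < k"
  shows "i * k + r < n * k" "(i * k + r) div k = i" "(i * k + r) mod k = r"
proof -
  have "i * k + r < Suc i * k" using assms by simp
  also have "\<dots> \<le> n * k" using assms by (intro mult_le_mono1) simp
  finally show "i * k + r < n * k" .
qed (use assms in auto)

lemma sum_blocks:
  fixes f :: "nat \<Rightarrow> 'a :: comm_monoid_add"
  shows "(\<Sum>x<n * k. f x) = (\<Sum>i<n. \<Sum>r<k. f (i * k + r))"
proof -
  have "(\<Sum>x<n * k. f x) = (\<Sum>i<n. sum f {i * k..<i * k + k})"
    by (rule sum.nat_group[symmetric])
  also have "\<dots> = (\<Sum>i<n. \<Sum>r<k. f (i * k + r))"
  proof (rule sum.cong)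
    show "sum f {i * k..<i * k + k} = (\<Sum>r<k. f (i * k + r))" for i
      using sum.shift_bounds_nat_ivl[of f 0 "i * k" k] by (simp add: lessThan_atLeast0 add.commute)
  qed simp
  finally show ?thesis .
qed

lemma unitary_trivial_representation:
  "unitary_representation G k (\<lambda>_. 1\<^sub>m k)"
  by (simp add: unitary_representation_iff unitary_mat_one)

lemma walk_gain_Cons:
  "w \<noteq> [] \<Longrightarrow> walk_gain G \<Psi> (u # w) = \<Psi> (u, hd w) \<otimes>\<^bsub>G\<^esub> walk_gain G \<Psi> w"
  by (simp add: walk_gain_def)

lemma walk_gain_single: "walk_gain G \<Psi> [u] = \<one>\<^bsub>G\<^esub>"
  by (simp add: walk_gain_def)

section \<open>Represented adjacency matrices of a gain graph\<close>

locale enumerated_gain_graph =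
  fixes G :: "('g, 'm) monoid_scheme" (structure)
    and \<Gamma> :: "'v pair_pre_digraph" and \<Psi> :: "'v \<times> 'v \<Rightarrow> 'g" and vs :: "'v list"
  assumes group: "group G" and graph: "pair_graph \<Gamma>" and gain: "gain_function G \<Gamma> \<Psi>"
    and distinct: "distinct vs" and verts: "set vs = pverts \<Gamma>"
begin

abbreviation nverts where "nverts \<equiv> length vs"

abbreviation adj :: "nat \<Rightarrow> nat \<Rightarrow> bool" where
  "adj i j \<equiv> (vs ! i, vs ! j) \<in> parcs \<Gamma>"

abbreviation rep_adj where
  "rep_adj \<equiv> represented_adjacency_matrix \<Gamma> \<Psi> vs"

abbreviation trivial_rep :: "'g \<Rightarrow> complex mat" where
  "trivial_rep \<equiv> \<lambda>_. 1\<^sub>m 1"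

lemma arc_sym: "(u, v) \<in> parcs \<Gamma> \<longleftrightarrow> (v, u) \<in> parcs \<Gamma>"
proof -
  interpret pair_graph \<Gamma> by (rule graph)
  show ?thesis using pair_sym_arcs by (auto simp: symmetric_def dest: symD)
qed

lemma arc_verts:
  assumes "(u, v) \<in> parcs \<Gamma>" shows "u \<in> pverts \<Gamma>" "v \<in> pverts \<Gamma>"
proof -
  interpret pair_graph \<Gamma> by (rule graph)
  show "u \<in> pverts \<Gamma>" "v \<in> pverts \<Gamma>" using in_arcsD1 in_arcsD2 assms by blast+
qed

lemma gain_carrier: "e \<in> parcs \<Gamma> \<Longrightarrow> \<Psi> e \<in> carrier G"
  using gain by (auto simp: gain_function_def)

lemma gain_inv: "(u, v) \<in> parcs \<Gamma> \<Longrightarrow> \<Psi> (u, v) = inv (\<Psi> (v, u))"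
  using gain by (auto simp: gain_function_def)

lemma walk_gain_carrier:
  assumes "vwalk w (with_proj \<Gamma>)" shows "walk_gain G \<Psi> w \<in> carrier G"
  using assms
proof (induction rule: vwalk_induct)
  case (Base u)
  show ?case using group by (simp add: walk_gain_single group.is_monoid monoid.one_closed)
next
  case (Cons u v es)
  then show ?case
    using group gain_carrier[of "(u, v)"]
    by (simp add: walk_gain_Cons group.is_monoid monoid.m_closed)
qed

lemma rep_adj_carrier: "rep_adj k \<pi> \<in> carrier_mat (nverts * k) (nverts * k)"
  by (simp add: represented_adjacency_matrix_def)

lemma rep_adj_index:
  assumes "i < nverts" "j < nverts" "r < k" "s < k"
  shows "rep_adj k \<pi> $$ (i * k + r, j * k + s) = (if adj i j then \<pi> (\<Psi> (vs ! i, vs ! j)) $$ (r, s) else 0)"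
  using block_index[OF assms(1,3)] block_index[OF assms(2,4)]
  by (simp add: represented_adjacency_matrix_def)

text \<open>Lets every fact about represented matrices specialize to the plain adjacency
  matrix.\<close>

lemma adjacency_eq_rep_adj: "adjacency_matrix \<Gamma> vs = rep_adj 1 trivial_rep"
  by (rule eq_matI) (auto simp: adjacency_matrix_def represented_adjacency_matrix_def)

lemma unitary_rep_carrier:
  "unitary_representation G k \<pi> \<Longrightarrow> g \<in> carrier G \<Longrightarrow> \<pi> g \<in> carrier_mat k k"
  by (simp add: unitary_representation_iff unitary_mat_def)

text \<open>Reversing an arc inverts its gain, and a unitary representation turns inverses into
  adjoints.\<close>

lemma rep_adj_hermitian:
  assumes \<pi>: "unitary_representation G k \<pi>"
  shows "mat_adjoint (rep_adj k \<pi>) = rep_adj k \<pi>"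
proof (rule eq_matI)
  fix x y assume "x < dim_row (rep_adj k \<pi>)" "y < dim_col (rep_adj k \<pi>)"
  then have xy: "x < nverts * k" "y < nverts * k" using rep_adj_carrier[of k \<pi>] by auto
  then have k: "k > 0" by (cases k) auto
  let ?u = "vs ! (x div k)" and ?v = "vs ! (y div k)"
  show "mat_adjoint (rep_adj k \<pi>) $$ (x, y) = rep_adj k \<pi> $$ (x, y)"
  proof (cases "(?u, ?v) \<in> parcs \<Gamma>")
    case True
    then have vu: "(?v, ?u) \<in> parcs \<Gamma>" using arc_sym by blast
    have "\<pi> (\<Psi> (?u, ?v)) = mat_adjoint (\<pi> (\<Psi> (?v, ?u)))"
      using gain_inv[OF True] unitary_representation_inv[OF group \<pi> gain_carrier[OF vu]] by simp
    then show ?thesis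
      using xy k True vu unitary_rep_carrier[OF \<pi> gain_carrier[OF vu]] rep_adj_carrier[of k \<pi>]
      by (simp add: represented_adjacency_matrix_def)
  next
    case False
    then have "(?v, ?u) \<notin> parcs \<Gamma>" using arc_sym by blast
    then show ?thesis
      using xy False rep_adj_carrier[of k \<pi>] by (simp add: represented_adjacency_matrix_def)
  qed
qed (use rep_adj_carrier[of k \<pi>] in auto)

section \<open>Walks, powers of the matrix and moments\<close>

definition walks :: "nat \<Rightarrow> 'v \<Rightarrow> 'v \<Rightarrow> 'v list set" where
  "walks h u v = {w. vwalk w (with_proj \<Gamma>) \<and> length w = Suc h \<and> hd w = u \<and> last w = v}"

text \<open>As in \<open>walks\<close>, \<open>h\<close> counts arcs, hence the \<open>Suc h\<close>
  vertices. Walks carry a base point: the same cycle started elsewhere is counted again, as the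
  trace requires.\<close>

definition closed_walks :: "nat \<Rightarrow> 'v list set" where
  "closed_walks h = {w. vwalk w (with_proj \<Gamma>) \<and> length w = Suc h \<and> hd w = last w}"

lemma finite_walk_set: "finite {w. vwalk w (with_proj \<Gamma>) \<and> length w = m}"
proof (rule finite_subset)
  show "{w. vwalk w (with_proj \<Gamma>) \<and> length w = m} \<subseteq> {w. set w \<subseteq> pverts \<Gamma> \<and> length w = m}"
    by (auto simp: vwalk_def)
  show "finite {w. set w \<subseteq> pverts \<Gamma> \<and> length w = m}"
    using verts by (intro finite_lists_length_eq) (metis List.finite_set)
qed

lemma finite_walks: "finite (walks h u v)" "finite (closed_walks h)"
  by (rule finite_subset[OF _ finite_walk_set[of "Suc h"]], auto simp: walks_def closed_walks_def)+

lemma walks_0: "u \<in> pverts \<Gamma> \<Longrightarrow> walks 0 u v = (if u = v then {[u]} else {})"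
  by (auto simp: walks_def length_Suc_conv vwalk_def)

lemma walks_Suc:
  assumes "i < nverts"
  shows "walks (Suc h) (vs ! i) v = (\<Union>l\<in>{l. l < nverts \<and> adj i l}. (#) (vs ! i) ` walks h (vs ! l) v)"
proof (intro equalityI subsetI)
  fix w assume "w \<in> walks (Suc h) (vs ! i) v"
  then have w: "vwalk w (with_proj \<Gamma>)" "length w = Suc (Suc h)" "hd w = vs ! i" "last w = v"
    by (auto simp: walks_def)
  then obtain w' where w': "w = vs ! i # w'" "w' \<noteq> []" "length w' = Suc h"
    by (cases w; cases "tl w") auto
  then have "(vs ! i, hd w') \<in> parcs \<Gamma>" "vwalk w' (with_proj \<Gamma>)"
    using w(1) by (auto elim: vwalk_consE)
  moreover from this obtain l where "l < nverts" "vs ! l = hd w'"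
    using arc_verts verts by (metis in_set_conv_nth)
  ultimately show "w \<in> (\<Union>l\<in>{l. l < nverts \<and> adj i l}. (#) (vs ! i) ` walks h (vs ! l) v)"
    using w w' by (auto simp: walks_def)
next
  fix w assume "w \<in> (\<Union>l\<in>{l. l < nverts \<and> adj i l}. (#) (vs ! i) ` walks h (vs ! l) v)"
  then obtain l w' where w': "w = vs ! i # w'" "l < nverts" "adj i l" "vwalk w' (with_proj \<Gamma>)"
    "length w' = Suc h" "hd w' = vs ! l" "last w' = v"
    by (auto simp: walks_def)
  then show "w \<in> walks (Suc h) (vs ! i) v"
    using arc_verts by (auto simp: walks_def intro!: vwalk_consI)
qed

text \<open>Expanding the leftmost factor selects the second vertex of the walk. Multiplicativity of
  \<open>\<pi>\<close> then merges the block of the first arc with that of the remaining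
  walk.\<close>

lemma rep_adj_power_index:
  assumes \<pi>: "unitary_representation G k \<pi>"
    and "i < nverts" "j < nverts" "r < k" "s < k"
  shows "(rep_adj k \<pi> ^\<^sub>m h) $$ (i * k + r, j * k + s) =
    (\<Sum>w\<in>walks h (vs ! i) (vs ! j). \<pi> (walk_gain G \<Psi> w) $$ (r, s))"
  using assms(2-5)
proof (induction h arbitrary: i r)
  case 0
  note b = block_index[OF 0(1,3)] block_index[OF 0(2,4)]
  have "i * k + r = j * k + s \<longleftrightarrow> i = j \<and> r = s" using b by metis
  moreover have "vs ! i = vs ! j \<longleftrightarrow> i = j" using 0 distinct by (simp add: nth_eq_iff_index_eq)
  moreover have "vs ! i \<in> pverts \<Gamma>" using 0(1) nth_mem verts by metis
  moreover have "(rep_adj k \<pi> ^\<^sub>m 0) $$ (i * k + r, j * k + s) =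
      (if i * k + r = j * k + s then 1 else 0)"
    using b(1,4) carrier_matD[OF rep_adj_carrier[of k \<pi>]] by simp
  ultimately show ?case
    using 0(3,4) unitary_representation_one[OF group \<pi>] by (simp add: walks_0 walk_gain_single)
next
  case (Suc h)
  let ?A = "rep_adj k \<pi>"
  note A = rep_adj_carrier[of k \<pi>]
  note b = block_index[OF Suc.prems(1,3)] block_index[OF Suc.prems(2,4)]
  let ?L = "{l. l < nverts \<and> adj i l}"
  have gains: "\<pi> (walk_gain G \<Psi> (vs ! i # w)) $$ (r, s) =
      (\<Sum>t<k. \<pi> (\<Psi> (vs ! i, vs ! l)) $$ (r, t) * \<pi> (walk_gain G \<Psi> w) $$ (t, s))"
    if "l \<in> ?L" "w \<in> walks h (vs ! l) (vs ! j)" for l w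
  proof -
    have w: "vwalk w (with_proj \<Gamma>)" "hd w = vs ! l" "w \<noteq> []" using that by (auto simp: walks_def)
    have c: "\<Psi> (vs ! i, vs ! l) \<in> carrier G" "walk_gain G \<Psi> w \<in> carrier G"
      using that gain_carrier walk_gain_carrier[OF w(1)] by auto
    have "\<pi> (walk_gain G \<Psi> (vs ! i # w)) = \<pi> (\<Psi> (vs ! i, vs ! l)) * \<pi> (walk_gain G \<Psi> w)"
      using \<pi> c w by (simp add: walk_gain_Cons unitary_representation_iff)
    then show ?thesis
      using unitary_rep_carrier[OF \<pi> c(1)] unitary_rep_carrier[OF \<pi> c(2)] Suc.prems
      by (simp add: scalar_prod_def lessThan_atLeast0)
  qed
  have "(?A ^\<^sub>m Suc h) $$ (i * k + r, j * k + s) =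
      (\<Sum>x<nverts * k. ?A $$ (i * k + r, x) * (?A ^\<^sub>m h) $$ (x, j * k + s))"
    unfolding pow_mat_Suc_left[OF A] using A b pow_carrier_mat[OF A, of h]
    by (simp add: scalar_prod_def lessThan_atLeast0)
  also have "\<dots> = (\<Sum>l<nverts. \<Sum>t<k. ?A $$ (i * k + r, l * k + t) * (?A ^\<^sub>m h) $$ (l * k + t, j * k + s))"
    by (rule sum_blocks)
  also have "\<dots> = (\<Sum>l<nverts. \<Sum>t<k. (if adj i l then \<pi> (\<Psi> (vs ! i, vs ! l)) $$ (r, t) else 0) *
      (\<Sum>w\<in>walks h (vs ! l) (vs ! j). \<pi> (walk_gain G \<Psi> w) $$ (t, s)))"
    using Suc.IH Suc.prems by (intro sum.cong refl) (simp add: rep_adj_index)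
  also have "\<dots> = (\<Sum>l\<in>?L. \<Sum>t<k. \<pi> (\<Psi> (vs ! i, vs ! l)) $$ (r, t) *
      (\<Sum>w\<in>walks h (vs ! l) (vs ! j). \<pi> (walk_gain G \<Psi> w) $$ (t, s)))"
    by (rule sum.mono_neutral_cong_right) auto
  also have "\<dots> = (\<Sum>l\<in>?L. \<Sum>w\<in>walks h (vs ! l) (vs ! j). \<Sum>t<k.
      \<pi> (\<Psi> (vs ! i, vs ! l)) $$ (r, t) * \<pi> (walk_gain G \<Psi> w) $$ (t, s))"
    unfolding sum_distrib_left by (intro sum.cong refl sum.swap)
  also have "\<dots> = (\<Sum>l\<in>?L. \<Sum>w\<in>walks h (vs ! l) (vs ! j). \<pi> (walk_gain G \<Psi> (vs ! i # w)) $$ (r, s))"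
    using gains by (intro sum.cong refl) simp
  also have "\<dots> = (\<Sum>l\<in>?L. \<Sum>w\<in>(#) (vs ! i) ` walks h (vs ! l) (vs ! j). \<pi> (walk_gain G \<Psi> w) $$ (r, s))"
    by (simp add: sum.reindex)
  also have "\<dots> = (\<Sum>w\<in>walks (Suc h) (vs ! i) (vs ! j). \<pi> (walk_gain G \<Psi> w) $$ (r, s))"
    unfolding walks_Suc[OF Suc.prems(1)]
  proof (rule sum.UNION_disjoint[symmetric])
    show "\<forall>l\<in>?L. \<forall>m\<in>?L. l \<noteq> m \<longrightarrow>
      (#) (vs ! i) ` walks h (vs ! l) (vs ! j) \<inter> (#) (vs ! i) ` walks h (vs ! m) (vs ! j) = {}"
      using distinct by (auto simp: walks_def nth_eq_iff_index_eq)
  qed (auto simp: finite_walks)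
  finally show ?case .
qed

lemma rep_adj_power_trace:
  assumes \<pi>: "unitary_representation G k \<pi>"
  shows "(\<Sum>x<nverts * k. (rep_adj k \<pi> ^\<^sub>m h) $$ (x, x)) =
    (\<Sum>w\<in>closed_walks h. \<Sum>r<k. \<pi> (walk_gain G \<Psi> w) $$ (r, r))"
proof -
  have closed: "closed_walks h = (\<Union>i\<in>{..<nverts}. walks h (vs ! i) (vs ! i))"
  proof (intro equalityI subsetI)
    fix w assume w: "w \<in> closed_walks h"
    then have "hd w \<in> pverts \<Gamma>" by (auto simp: closed_walks_def vwalk_def)
    then obtain i where "i < nverts" "vs ! i = hd w" using verts by (metis in_set_conv_nth)
    moreover from this have "w \<in> walks h (vs ! i) (vs ! i)"
      using w by (auto simp: closed_walks_def walks_def)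
    ultimately show "w \<in> (\<Union>i\<in>{..<nverts}. walks h (vs ! i) (vs ! i))" by blast
  qed (auto simp: closed_walks_def walks_def)
  have "(\<Sum>x<nverts * k. (rep_adj k \<pi> ^\<^sub>m h) $$ (x, x)) =
      (\<Sum>i<nverts. \<Sum>r<k. (rep_adj k \<pi> ^\<^sub>m h) $$ (i * k + r, i * k + r))"
    by (rule sum_blocks)
  also have "\<dots> = (\<Sum>i<nverts. \<Sum>r<k. \<Sum>w\<in>walks h (vs ! i) (vs ! i). \<pi> (walk_gain G \<Psi> w) $$ (r, r))"
    by (simp add: rep_adj_power_index[OF \<pi>])
  also have "\<dots> = (\<Sum>i<nverts. \<Sum>w\<in>walks h (vs ! i) (vs ! i). \<Sum>r<k. \<pi> (walk_gain G \<Psi> w) $$ (r, r))"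
    by (intro sum.cong refl sum.swap)
  also have "\<dots> = (\<Sum>w\<in>closed_walks h. \<Sum>r<k. \<pi> (walk_gain G \<Psi> w) $$ (r, r))"
    unfolding closed
  proof (rule sum.UNION_disjoint[symmetric])
    show "\<forall>i\<in>{..<nverts}. \<forall>j\<in>{..<nverts}. i \<noteq> j \<longrightarrow>
      walks h (vs ! i) (vs ! i) \<inter> walks h (vs ! j) (vs ! j) = {}"
      using distinct by (auto simp: walks_def nth_eq_iff_index_eq)
  qed (auto simp: finite_walks)
  finally show ?thesis .
qed

lemma moments_rep_adj:
  assumes "unitary_representation G k \<pi>"
  shows "(\<Sum>e\<in>#spectrum_mset (rep_adj k \<pi>). e ^ h) =
    (\<Sum>w\<in>closed_walks h. \<Sum>r<k. \<pi> (walk_gain G \<Psi> w) $$ (r, r))"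
  using trace_power_hermitian[OF rep_adj_carrier rep_adj_hermitian[OF assms]]
    rep_adj_power_trace[OF assms] by simp

lemma moments_adjacency:
  "(\<Sum>e\<in>#spectrum_mset (adjacency_matrix \<Gamma> vs). e ^ h) = of_nat (card (closed_walks h))"
  using moments_rep_adj[OF unitary_trivial_representation[of G 1]]
  by (simp add: adjacency_eq_rep_adj)

lemma moments_repeat_adjacency:
  "(\<Sum>e\<in>#repeat_mset k (spectrum_mset (adjacency_matrix \<Gamma> vs)). e ^ h) =
    of_nat k * of_nat (card (closed_walks h))"
proof -
  have "(\<Sum>e\<in>#repeat_mset k M. f e) = of_nat k * (\<Sum>e\<in>#M. f e)" for M and f :: "complex \<Rightarrow> complex"
  proof (induction k)
    case (Suc k)
    then show ?case
      by (simp only: repeat_mset_Suc image_mset_union sum_mset.union of_nat_Suc distrib_right mult_1_left)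
  qed simp
  then show ?thesis by (simp only: moments_adjacency)
qed

text \<open>Every closed walk contributes the trace of the identity matrix, \<open>k\<close>, so all
  moments are \<open>k\<close> times those of the plain adjacency matrix.\<close>

lemma balanced_imp_spectrum:
  assumes "balanced G \<Gamma> \<Psi>" and \<pi>: "unitary_representation G k \<pi>"
  shows "spectrum_mset (rep_adj k \<pi>) = repeat_mset k (spectrum_mset (adjacency_matrix \<Gamma> vs))"
proof (rule mset_eq_if_moments_eq)
  fix h
  have "walk_gain G \<Psi> w = \<one>" if "w \<in> closed_walks h" for w
    using assms(1) that by (auto simp: balanced_def closed_walks_def)
  then show "(\<Sum>e\<in>#spectrum_mset (rep_adj k \<pi>). e ^ h) =
      (\<Sum>e\<in>#repeat_mset k (spectrum_mset (adjacency_matrix \<Gamma> vs)). e ^ h)"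
    unfolding moments_rep_adj[OF \<pi>] moments_repeat_adjacency
    by (simp add: unitary_representation_one[OF group \<pi>] mult.commute)
qed

text \<open>Equal moments say that \<open>k\<close> minus the real part of the trace sums to zero
  over all closed walks of the length of \<open>w\<close>. Each term is nonnegative, so the one at
  \<open>w\<close> vanishes, which is the equality case of the trace bound.\<close>

lemma spectrum_imp_trivial_gain:
  assumes \<pi>: "unitary_representation G k \<pi>"
    and spec: "spectrum_mset (rep_adj k \<pi>) = repeat_mset k (spectrum_mset (adjacency_matrix \<Gamma> vs))"
    and w: "vwalk w (with_proj \<Gamma>)" "hd w = last w"
  shows "\<pi> (walk_gain G \<Psi> w) = 1\<^sub>m k"
proof -
  define h where "h = length w - 1"
  have wh: "w \<in> closed_walks h" using w by (cases w) (auto simp: closed_walks_def h_def)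
  have u: "unitary_mat k (\<pi> (walk_gain G \<Psi> v))" if "v \<in> closed_walks h" for v
    using that \<pi> walk_gain_carrier by (auto simp: closed_walks_def unitary_representation_iff)
  let ?t = "\<lambda>v. Re (\<Sum>r<k. \<pi> (walk_gain G \<Psi> v) $$ (r, r))"
  have "(\<Sum>v\<in>closed_walks h. \<Sum>r<k. \<pi> (walk_gain G \<Psi> v) $$ (r, r)) =
      of_nat k * of_nat (card (closed_walks h))"
    using moments_rep_adj[OF \<pi>, of h] moments_repeat_adjacency[of h k] spec by simp
  from arg_cong[OF this, of Re] have "(\<Sum>v\<in>closed_walks h. k - ?t v) = 0"
    by (simp add: sum_subtractf)
  then have "k - ?t w = 0"
    using sum_nonneg_eq_0_iff[OF finite_walks(2)[of h], of "\<lambda>v. k - ?t v"] unitary_trace_le[OF u] wh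
    by auto
  then show ?thesis using unitary_trace_eq_imp_one[OF u[OF wh]] by simp
qed

text \<open>The common end of both converses: a gain other than the identity would be detected by
  some irreducible unitary representation.\<close>

lemma balanced_if_trivial_gains:
  assumes "finite (carrier G)"
    and "\<And>k \<pi> w. unitary_representation G k \<pi> \<Longrightarrow> irreducible_representation G k \<pi> \<Longrightarrow>
      vwalk w (with_proj \<Gamma>) \<Longrightarrow> hd w = last w \<Longrightarrow> \<pi> (walk_gain G \<Psi> w) = 1\<^sub>m k"
  shows "balanced G \<Gamma> \<Psi>"
  using exists_irreducible_nontrivial[OF group assms(1)] assms(2) walk_gain_carrier
  unfolding balanced_def by metis

end

section \<open>Perron vectors and top eigenvectors\<close>

lemma eigenvalue_iff_spectrum_mset:
  assumes A: "A \<in> carrier_mat n n"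
  shows "eigenvalue A e \<longleftrightarrow> e \<in># spectrum_mset A"
proof -
  have "char_poly A \<noteq> 0" using degree_monic_char_poly[OF A] by auto
  then show ?thesis by (simp add: eigenvalue_root_char_poly[OF A] spectrum_mset_def)
qed

lemma largest_eigenvalue_hermitian:
  assumes A: "A \<in> carrier_mat n n" and n: "n > 0"
    and us: "orthonormal n us" "length us = n"
    and ev: "\<And>i. i < n \<Longrightarrow> A *\<^sub>v us ! i = complex_of_real (d i) \<cdot>\<^sub>v us ! i"
  shows "largest_eigenvalue A = Max (d ` {..<n})"
proof -
  have "spectrum_mset A = mset (map (\<lambda>i. complex_of_real (d i)) [0..<n])"
    by (rule spectrum_mset_hermitian[OF A us ev])
  then have "{x. eigenvalue A (complex_of_real x)} = d ` {..<n}"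
    unfolding eigenvalue_iff_spectrum_mset[OF A] by (auto simp: lessThan_atLeast0)
  then show ?thesis by (simp add: largest_eigenvalue_def)
qed

text \<open>In coordinates of an eigenbasis the difference of the two sides is the sum of
  \<open>(l - d i) * |c i|^2\<close> with nonnegative terms. In the equality case \<open>c\<close>
  is supported where \<open>d i = l\<close>, so \<open>y\<close> is an eigenvector or zero.\<close>

lemma rayleigh_quotient:
  assumes A: "A \<in> carrier_mat n n" and herm: "mat_adjoint A = A" and n: "n > 0"
    and y: "y \<in> carrier_vec n"
  shows "Re ((A *\<^sub>v y) \<bullet>c y) \<le> largest_eigenvalue A * Re (y \<bullet>c y)"
    and "Re ((A *\<^sub>v y) \<bullet>c y) = largest_eigenvalue A * Re (y \<bullet>c y) \<Longrightarrow>
      A *\<^sub>v y = complex_of_real (largest_eigenvalue A) \<cdot>\<^sub>v y"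
proof -
  obtain us d where us: "orthonormal n us" "length us = n"
    and ev: "\<And>i. i < n \<Longrightarrow> A *\<^sub>v us ! i = complex_of_real (d i) \<cdot>\<^sub>v us ! i"
    using hermitian_orthonormal_eigenbasis[OF A herm] by blast
  define l where "l = largest_eigenvalue A"
  have "l = Max (d ` {..<n})"
    unfolding l_def by (rule largest_eigenvalue_hermitian[OF A n us ev])
  then have le: "d i \<le> l" if "i < n" for i using that by simp
  define U where "U = mat_of_cols n us"
  define D where "D = mat_diag n (\<lambda>i. complex_of_real (d i))"
  note U = orthonormal_full_unitary[OF us, folded U_def]
  note Ua = mat_adjoint_carrier[OF U(1)]
  have D: "D \<in> carrier_mat n n" by (simp add: D_def)
  have AUD: "A = U * D * mat_adjoint U"
    using similar_mat_witD2(3)[OF A hermitian_diagonalization[OF A us ev]] by (simp only: U_def D_def)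
  define c where "c = mat_adjoint U *\<^sub>v y"
  have c: "c \<in> carrier_vec n" using Ua y by (simp add: c_def)
  have Dc: "D *\<^sub>v c \<in> carrier_vec n" using D c by simp
  have yU: "y = U *\<^sub>v c"
    using assoc_mult_mat_vec[OF U(1) Ua y] U(3) y by (simp add: c_def)
  have Ay: "A *\<^sub>v y = U *\<^sub>v (D *\<^sub>v c)"
    unfolding AUD c_def
    using assoc_mult_mat_vec[OF mult_carrier_mat[OF U(1) D] Ua y]
      assoc_mult_mat_vec[OF U(1) D, of "mat_adjoint U *\<^sub>v y"] c by (simp add: c_def)
  have Di: "(D *\<^sub>v c) $ i = complex_of_real (d i) * c $ i" if "i < n" for i
  proof -
    have "(D *\<^sub>v c) $ i = (\<Sum>j<n. (if i = j then complex_of_real (d j) else 0) * c $ j)"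
      using that D c by (simp add: scalar_prod_def lessThan_atLeast0 D_def mat_diag_def)
    also have "\<dots> = (\<Sum>j<n. if i = j then complex_of_real (d j) * c $ j else 0)"
      by (intro sum.cong) auto
    finally show ?thesis using that by simp
  qed
  have "(A *\<^sub>v y) \<bullet>c y = (D *\<^sub>v c) \<bullet>c c"
    unfolding Ay using cscalar_prod_adjoint[OF U(1) Dc y] by (simp add: c_def)
  also have "\<dots> = (\<Sum>i<n. complex_of_real (d i * (cmod (c $ i))\<^sup>2))"
    using Di c by (simp add: scalar_prod_def lessThan_atLeast0 complex_norm_square mult.assoc
        flip: of_real_power)
  finally have 1: "Re ((A *\<^sub>v y) \<bullet>c y) = (\<Sum>i<n. d i * (cmod (c $ i))\<^sup>2)" by simp
  have "y \<bullet>c y = (U *\<^sub>v c) \<bullet>c y" using yU by simp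
  also have "\<dots> = c \<bullet>c c"
    using cscalar_prod_adjoint[OF U(1) c y] by (simp add: c_def)
  finally have 2: "Re (y \<bullet>c y) = (\<Sum>i<n. (cmod (c $ i))\<^sup>2)"
    using c by (simp add: cscalar_prod_self)
  have diff: "l * Re (y \<bullet>c y) - Re ((A *\<^sub>v y) \<bullet>c y) = (\<Sum>i<n. (l - d i) * (cmod (c $ i))\<^sup>2)"
    unfolding 1 2 by (simp add: sum_distrib_left sum_subtractf left_diff_distrib)
  have nonneg: "(l - d i) * (cmod (c $ i))\<^sup>2 \<ge> 0" if "i < n" for i using le[OF that] by simp
  then have "(\<Sum>i<n. (l - d i) * (cmod (c $ i))\<^sup>2) \<ge> 0" by (intro sum_nonneg) auto
  with diff show "Re ((A *\<^sub>v y) \<bullet>c y) \<le> largest_eigenvalue A * Re (y \<bullet>c y)"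
    by (simp add: l_def)
  assume "Re ((A *\<^sub>v y) \<bullet>c y) = largest_eigenvalue A * Re (y \<bullet>c y)"
  then have "(\<Sum>i<n. (l - d i) * (cmod (c $ i))\<^sup>2) = 0" using diff by (simp add: l_def)
  then have "(l - d i) * (cmod (c $ i))\<^sup>2 = 0" if "i < n" for i
    using sum_nonneg_eq_0_iff[of "{..<n}" "\<lambda>i. (l - d i) * (cmod (c $ i))\<^sup>2"] nonneg that by auto
  then have "D *\<^sub>v c = complex_of_real l \<cdot>\<^sub>v c"
    using Di D c by (intro eq_vecI) auto
  then have "A *\<^sub>v y = complex_of_real l \<cdot>\<^sub>v y"
    unfolding Ay using mult_mat_vec[OF U(1) c] yU by simp
  then show "A *\<^sub>v y = complex_of_real (largest_eigenvalue A) \<cdot>\<^sub>v y" by (simp add: l_def)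
qed

text \<open>Converts algebraic multiplicity, which is what the multiset counts, into that many
  orthonormal eigenvectors: the members of an eigenbasis that belong to \<open>e\<close>.\<close>

lemma hermitian_eigenvectors_of_count:
  assumes A: "A \<in> carrier_mat n n" and herm: "mat_adjoint A = A"
  obtains xs where "orthonormal n xs" "length xs = count (spectrum_mset A) e"
    "\<And>x. x \<in> set xs \<Longrightarrow> A *\<^sub>v x = e \<cdot>\<^sub>v x"
proof -
  obtain us d where us: "orthonormal n us" "length us = n"
    and ev: "\<And>i. i < n \<Longrightarrow> A *\<^sub>v us ! i = complex_of_real (d i) \<cdot>\<^sub>v us ! i"
    using hermitian_orthonormal_eigenbasis[OF A herm] by blast
  define I where "I = filter (\<lambda>i. complex_of_real (d i) = e) [0..<n]"
  have I: "distinct I" "\<And>i. i \<in> set I \<Longrightarrow> i < n \<and> complex_of_real (d i) = e"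
    by (auto simp: I_def)
  have I': "I ! j < n" if "j < length I" for j using I(2)[OF nth_mem[OF that]] by simp
  show ?thesis
  proof
    show "orthonormal n (map ((!) us) I)"
      using us I' I(1) unfolding orthonormal_iff by (auto simp: nth_eq_iff_index_eq dest!: I(2))
    have "spectrum_mset A = mset (map (\<lambda>i. complex_of_real (d i)) [0..<n])"
      by (rule spectrum_mset_hermitian[OF A us ev])
    moreover have "count (mset (map f js)) e = length (filter (\<lambda>i. f i = e) js)"
      for f :: "nat \<Rightarrow> complex" and js
      by (induction js) auto
    ultimately show "length (map ((!) us) I) = count (spectrum_mset A) e" by (simp only: I_def length_map)
    show "A *\<^sub>v x = e \<cdot>\<^sub>v x" if "x \<in> set (map ((!) us) I)" for x
      using that I ev by auto
  qed
qed

context enumerated_gain_graph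
begin

section \<open>Connected graphs and their Perron vectors\<close>

lemma connected_induct:
  assumes conn: "connected (with_proj \<Gamma>)" and i: "i < nverts" "Q i" and j: "j < nverts"
    and step: "\<And>i j. i < nverts \<Longrightarrow> j < nverts \<Longrightarrow> adj i j \<Longrightarrow> Q i \<Longrightarrow> Q j"
  shows "Q j"
proof -
  have "(vs ! i, vs ! j) \<in> rtrancl_on (pverts \<Gamma>) ((parcs \<Gamma>)\<^sup>s)"
  proof -
    interpret pair_graph \<Gamma> by (rule graph)
    have "vs ! i \<in> pverts \<Gamma>" "vs ! j \<in> pverts \<Gamma>" using i j verts by (metis nth_mem)+
    then show ?thesis using conn unfolding connected_conv by simp
  qed
  \<comment> \<open>The closure induction runs over vertices while \<open>Q\<close> speaks of
    indices, so the claim is made for every index of the current vertex.\<close>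
  then have "\<forall>l<nverts. vs ! l = vs ! j \<longrightarrow> Q l"
  proof (induction rule: rtrancl_on_induct)
    case base
    then show ?case using i distinct by (auto simp: nth_eq_iff_index_eq)
  next
    case (step y z)
    have yz: "(y, z) \<in> parcs \<Gamma>" using step(2) arc_sym by (auto simp: symcl_def)
    obtain m where m: "m < nverts" "vs ! m = y" using step(3) verts by (metis in_set_conv_nth)
    have "Q m" using step(5) m by auto
    then show ?case using assms(5)[OF m(1)] m yz by auto
  qed
  then show ?thesis using j by auto
qed

abbreviation top_eigenvalue :: real where
  "top_eigenvalue \<equiv> largest_eigenvalue (adjacency_matrix \<Gamma> vs)"

lemma adjacency_carrier: "adjacency_matrix \<Gamma> vs \<in> carrier_mat nverts nverts"
  by (simp add: adjacency_matrix_def)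

lemma adjacency_hermitian: "mat_adjoint (adjacency_matrix \<Gamma> vs) = adjacency_matrix \<Gamma> vs"
  unfolding adjacency_eq_rep_adj by (rule rep_adj_hermitian[OF unitary_trivial_representation])

lemma adjacency_mult_vec:
  assumes "i < nverts" "x \<in> carrier_vec nverts"
  shows "(adjacency_matrix \<Gamma> vs *\<^sub>v x) $ i = (\<Sum>j<nverts. if adj i j then x $ j else 0)"
  using assms
  by (auto simp: adjacency_matrix_def scalar_prod_def lessThan_atLeast0 intro!: sum.cong)

lemma nverts_pos: "connected (with_proj \<Gamma>) \<Longrightarrow> nverts > 0"
  using verts by (auto simp: connected_def strongly_connected_def)

lemma top_eigenvalue_in_spectrum:
  assumes "nverts > 0"
  shows "complex_of_real top_eigenvalue \<in># spectrum_mset (adjacency_matrix \<Gamma> vs)"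
proof -
  note A = adjacency_carrier
  obtain us d where us: "orthonormal nverts us" "length us = nverts"
    and ev: "\<And>i. i < nverts \<Longrightarrow> adjacency_matrix \<Gamma> vs *\<^sub>v us ! i = complex_of_real (d i) \<cdot>\<^sub>v us ! i"
    using hermitian_orthonormal_eigenbasis[OF A adjacency_hermitian] by blast
  have "top_eigenvalue = Max (d ` {..<nverts})"
    by (rule largest_eigenvalue_hermitian[OF A assms us ev])
  also have "\<dots> \<in> d ` {..<nverts}" using assms by (intro Max_in) auto
  finally have "top_eigenvalue \<in> d ` {..<nverts}" .
  moreover have "spectrum_mset (adjacency_matrix \<Gamma> vs) =
      mset (map (\<lambda>i. complex_of_real (d i)) [0..<nverts])"
    by (rule spectrum_mset_hermitian[OF A us ev])
  ultimately show ?thesis by (auto simp: lessThan_atLeast0)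
qed

text \<open>Replacing the entries of a top eigenvector by their absolute values does not decrease the
  Rayleigh quotient, so the result is again an eigenvector.\<close>

lemma perron_vector:
  assumes conn: "connected (with_proj \<Gamma>)"
  obtains p :: "nat \<Rightarrow> real" where "\<And>i. i < nverts \<Longrightarrow> p i > 0"
    "\<And>i. i < nverts \<Longrightarrow> (\<Sum>j<nverts. if adj i j then p j else 0) = top_eigenvalue * p i"
proof -
  let ?A = "adjacency_matrix \<Gamma> vs" and ?l = top_eigenvalue
  note A = adjacency_carrier
  have n: "nverts > 0" by (rule nverts_pos[OF conn])
  obtain x where x: "x \<in> carrier_vec nverts" "x \<noteq> 0\<^sub>v nverts" "?A *\<^sub>v x = complex_of_real ?l \<cdot>\<^sub>v x"
    using top_eigenvalue_in_spectrum[OF n] A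
    unfolding eigenvalue_iff_spectrum_mset[OF A, symmetric] eigenvalue_def eigenvector_def by auto
  define p where "p i = cmod (x $ i)" for i
  define y where "y = vec nverts (\<lambda>i. complex_of_real (p i))"
  have y: "y \<in> carrier_vec nverts" by (simp add: y_def)
  have yy: "y \<bullet>c y = x \<bullet>c x" using x by (simp add: cscalar_prod_self y_def p_def)
  have xx: "x \<bullet>c x = complex_of_real (Re (x \<bullet>c x))" "Re (x \<bullet>c x) \<ge> 0"
    by (simp_all add: cscalar_prod_self sum_nonneg)
  \<comment> \<open>The triangle inequality, together with the nonnegative entries of the adjacency
    matrix, bounds the quadratic form at \<open>x\<close> by that at \<open>y\<close>, and both
    vectors have the same norm.\<close>
  have "?l * Re (x \<bullet>c x) = Re ((?A *\<^sub>v x) \<bullet>c x)"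
    using x by simp
  also have "\<dots> \<le> cmod ((?A *\<^sub>v x) \<bullet>c x)" by (rule complex_Re_le_cmod)
  also have "\<dots> = cmod (\<Sum>i<nverts. \<Sum>j<nverts. if adj i j then x $ j * cnj (x $ i) else 0)"
    using x(1) A
    by (simp add: scalar_prod_def[of _ "conjugate x"] lessThan_atLeast0[symmetric]
        adjacency_mult_vec sum_distrib_right if_distrib[of "\<lambda>a. a * _"] del: index_mult_mat_vec cong: if_cong)
  also have "\<dots> \<le> (\<Sum>i<nverts. \<Sum>j<nverts. if adj i j then p j * p i else 0)"
    by (intro sum_norm_le) (auto simp: p_def norm_mult)
  also have "\<dots> = Re (\<Sum>i<nverts. (\<Sum>j<nverts. if adj i j then y $ j else 0) * cnj (y $ i))"
    by (auto simp: y_def sum_distrib_right intro!: sum.cong)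
  also have "(\<Sum>i<nverts. (\<Sum>j<nverts. if adj i j then y $ j else 0) * cnj (y $ i)) = (?A *\<^sub>v y) \<bullet>c y"
    using y A
    by (simp add: scalar_prod_def[of _ "conjugate y"] lessThan_atLeast0[symmetric]
        adjacency_mult_vec del: index_mult_mat_vec)
  finally have "?l * Re (y \<bullet>c y) \<le> Re ((?A *\<^sub>v y) \<bullet>c y)" using yy by simp
  then have Ay: "?A *\<^sub>v y = complex_of_real ?l \<cdot>\<^sub>v y"
    using rayleigh_quotient[OF A adjacency_hermitian n y] by linarith
  have p: "(\<Sum>j<nverts. if adj i j then p j else 0) = ?l * p i" if "i < nverts" for i
  proof -
    have "complex_of_real (\<Sum>j<nverts. if adj i j then p j else 0) =
        (\<Sum>j<nverts. if adj i j then y $ j else 0)"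
      by (auto simp: y_def intro!: sum.cong)
    also have "\<dots> = (?A *\<^sub>v y) $ i" using adjacency_mult_vec[OF that y] by simp
    also have "\<dots> = complex_of_real (?l * p i)" unfolding Ay using that by (simp add: y_def)
    finally show ?thesis using of_real_eq_iff by blast
  qed
  have "p i > 0" if i: "i < nverts" for i
  proof (rule ccontr)
    assume "\<not> p i > 0"
    then have "p i = 0" by (simp add: p_def)
    \<comment> \<open>Where \<open>p\<close> vanishes, the eigenvalue equation makes a sum of
      nonnegative terms zero, so \<open>p\<close> vanishes at all neighbours; connectedness spreads
      this to the whole graph.\<close>
    have "p j = 0" if "j < nverts" for j
      using conn i \<open>p i = 0\<close> that
    proof (rule connected_induct)
      fix i j assume "i < nverts" "j < nverts" "adj i j" "p i = 0"
      then have "(\<Sum>j<nverts. if adj i j then p j else 0) = 0" using p by simp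
      then have "(if adj i j then p j else 0) = 0"
        using \<open>j < nverts\<close>
          sum_nonneg_eq_0_iff[of "{..<nverts}" "\<lambda>j. if adj i j then p j else 0"]
        by (auto simp: p_def)
      then show "p j = 0" using \<open>adj i j\<close> by simp
    qed
    then have "x = 0\<^sub>v nverts" using x(1) by (intro eq_vecI) (auto simp: p_def)
    with x(2) show False by simp
  qed
  with p that show ?thesis by blast
qed

end

lemma unitary_mult_vec_norm:
  assumes U: "unitary_mat k U" and v: "v \<in> carrier_vec k"
  shows "(\<Sum>r<k. (cmod ((U *\<^sub>v v) $ r))\<^sup>2) = (\<Sum>r<k. (cmod (v $ r))\<^sup>2)"
proof -
  have c: "U \<in> carrier_mat k k" "mat_adjoint U * U = 1\<^sub>m k" using U by (auto simp: unitary_mat_def)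
  have "(U *\<^sub>v v) \<bullet>c (U *\<^sub>v v) = v \<bullet>c (mat_adjoint U *\<^sub>v (U *\<^sub>v v))"
    by (rule cscalar_prod_adjoint[OF c(1) v]) (use c v in simp)
  also have "mat_adjoint U *\<^sub>v (U *\<^sub>v v) = v"
    using assoc_mult_mat_vec[OF mat_adjoint_carrier[OF c(1)] c(1) v] c(2) v by simp
  finally have "complex_of_real (\<Sum>r<k. (cmod ((U *\<^sub>v v) $ r))\<^sup>2) =
      complex_of_real (\<Sum>r<k. (cmod (v $ r))\<^sup>2)"
    unfolding cscalar_prod_self using c v by simp
  then show ?thesis using of_real_eq_iff by blast
qed

context enumerated_gain_graph
begin

section \<open>Top eigenvectors of the represented adjacency matrix\<close>

definition block :: "nat \<Rightarrow> complex vec \<Rightarrow> nat \<Rightarrow> complex vec" where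
  "block k x i = vec k (\<lambda>r. x $ (i * k + r))"

lemma block_carrier [simp]: "block k x i \<in> carrier_vec k"
  by (simp add: block_def)

lemma rep_adj_mult_vec:
  assumes \<pi>: "unitary_representation G k \<pi>" and x: "x \<in> carrier_vec (nverts * k)"
    and ir: "i < nverts" "r < k"
  shows "(rep_adj k \<pi> *\<^sub>v x) $ (i * k + r) =
    (\<Sum>j<nverts. if adj i j then (\<pi> (\<Psi> (vs ! i, vs ! j)) *\<^sub>v block k x j) $ r else 0)"
proof -
  note b = block_index[OF ir]
  have "(rep_adj k \<pi> *\<^sub>v x) $ (i * k + r) =
      (\<Sum>y<nverts * k. rep_adj k \<pi> $$ (i * k + r, y) * x $ y)"
    using carrier_matD[OF rep_adj_carrier[of k \<pi>]] x b(1)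
    by (simp add: scalar_prod_def lessThan_atLeast0)
  also have "\<dots> = (\<Sum>j<nverts. \<Sum>s<k. rep_adj k \<pi> $$ (i * k + r, j * k + s) * x $ (j * k + s))"
    by (rule sum_blocks)
  also have "\<dots> = (\<Sum>j<nverts. if adj i j then (\<pi> (\<Psi> (vs ! i, vs ! j)) *\<^sub>v block k x j) $ r else 0)"
  proof (intro sum.cong refl)
    fix j assume "j \<in> {..<nverts}"
    then show "(\<Sum>s<k. rep_adj k \<pi> $$ (i * k + r, j * k + s) * x $ (j * k + s)) =
        (if adj i j then (\<pi> (\<Psi> (vs ! i, vs ! j)) *\<^sub>v block k x j) $ r else 0)"
      using ir unitary_rep_carrier[OF \<pi> gain_carrier[of "(vs ! i, vs ! j)"]]
      by (auto simp: rep_adj_index scalar_prod_def lessThan_atLeast0 block_def)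
  qed
  finally show ?thesis .
qed

text \<open>With a Perron vector \<open>p\<close> and \<open>x\<^sub>i = p\<^sub>i y\<^sub>i\<close>, the sum of \<open>p\<^sub>i p\<^sub>j |y\<^sub>i - \<pi>(\<Psi>(i, j)) y\<^sub>j|\<^sup>2\<close>
  over all arcs expands to \<open>2 \<lambda> |x|\<^sup>2 - 2 Re \<langle>x, A\<^sub>\<pi> x\<rangle>\<close>, which vanishes for a top eigenvector.\<close>

lemma top_eigenvector_harmonic:
  assumes conn: "connected (with_proj \<Gamma>)" and \<pi>: "unitary_representation G k \<pi>"
  obtains p :: "nat \<Rightarrow> real" where "\<And>i. i < nverts \<Longrightarrow> p i > 0"
    "\<And>x i j. x \<in> carrier_vec (nverts * k) \<Longrightarrow>
      rep_adj k \<pi> *\<^sub>v x = complex_of_real top_eigenvalue \<cdot>\<^sub>v x \<Longrightarrow>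
      i < nverts \<Longrightarrow> j < nverts \<Longrightarrow> adj i j \<Longrightarrow>
      complex_of_real (1 / p i) \<cdot>\<^sub>v block k x i =
        \<pi> (\<Psi> (vs ! i, vs ! j)) *\<^sub>v (complex_of_real (1 / p j) \<cdot>\<^sub>v block k x j)"
proof -
  obtain p :: "nat \<Rightarrow> real" where pos: "\<And>i. i < nverts \<Longrightarrow> p i > 0"
    and perron: "\<And>i. i < nverts \<Longrightarrow> (\<Sum>j<nverts. if adj i j then p j else 0) = top_eigenvalue * p i"
    using perron_vector[OF conn] by blast
  let ?l = top_eigenvalue
  have "complex_of_real (1 / p i0) \<cdot>\<^sub>v block k x i0 =
        \<pi> (\<Psi> (vs ! i0, vs ! j0)) *\<^sub>v (complex_of_real (1 / p j0) \<cdot>\<^sub>v block k x j0)"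
    if x: "x \<in> carrier_vec (nverts * k)" "rep_adj k \<pi> *\<^sub>v x = complex_of_real ?l \<cdot>\<^sub>v x"
      and ij0: "i0 < nverts" "j0 < nverts" "adj i0 j0" for x i0 j0
  proof -
    define Y where "Y i = complex_of_real (1 / p i) \<cdot>\<^sub>v block k x i" for i
    define Z where "Z i j = \<pi> (\<Psi> (vs ! i, vs ! j)) *\<^sub>v Y j" for i j
    define N where "N i = (\<Sum>r<k. (cmod (Y i $ r))\<^sup>2)" for i
    \<comment> \<open>Symmetric weights, positive on arcs; by the Perron equation row
      \<open>i\<close> sums to the top eigenvalue times \<open>(p i)^2\<close>.\<close>
    define w where "w i j = (if adj i j then p i * p j else 0)" for i j
    have Yc: "Y i \<in> carrier_vec k" for i by (simp add: Y_def)
    have uni: "unitary_mat k (\<pi> (\<Psi> (vs ! i, vs ! j)))" if "adj i j" for i j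
      using \<pi> gain_carrier[OF that] by (simp add: unitary_representation_iff)
    then have \<pi>c: "\<pi> (\<Psi> (vs ! i, vs ! j)) \<in> carrier_mat k k" if "adj i j" for i j
      using that by (simp add: unitary_mat_def)
    have Zc: "Z i j \<in> carrier_vec k" if "adj i j" for i j
      using mult_mat_vec_carrier[OF \<pi>c[OF that] Yc] by (simp add: Z_def)
    have wsym: "w i j = w j i" for i j using arc_sym by (auto simp: w_def mult.commute)
    have wsum: "(\<Sum>j<nverts. w i j) = ?l * (p i)\<^sup>2" if "i < nverts" for i
    proof -
      have "(\<Sum>j<nverts. w i j) = p i * (\<Sum>j<nverts. if adj i j then p j else 0)"
        unfolding w_def sum_distrib_left by (intro sum.cong) auto
      then show ?thesis using perron[OF that] by (simp add: power2_eq_square)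
    qed
    \<comment> \<open>The eigenvalue equation of \<open>x\<close> in block row \<open>i\<close>; the
      factor \<open>p j\<close> undoes the division in \<open>Y j\<close>.\<close>
    have Zsum: "(\<Sum>j<nverts. if adj i j then complex_of_real (p j) * Z i j $ r else 0) =
        complex_of_real (?l * p i) * Y i $ r" if ir: "i < nverts" "r < k" for i r
    proof -
      have "(\<Sum>j<nverts. if adj i j then complex_of_real (p j) * Z i j $ r else 0) =
          (\<Sum>j<nverts. if adj i j then (\<pi> (\<Psi> (vs ! i, vs ! j)) *\<^sub>v block k x j) $ r else 0)"
      proof (intro sum.cong refl if_cong)
        fix j assume "j \<in> {..<nverts}" "adj i j"
        then have "Z i j = complex_of_real (1 / p j) \<cdot>\<^sub>v (\<pi> (\<Psi> (vs ! i, vs ! j)) *\<^sub>v block k x j)"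
          unfolding Z_def Y_def by (intro mult_mat_vec[OF \<pi>c]) auto
        then show "complex_of_real (p j) * Z i j $ r =
            (\<pi> (\<Psi> (vs ! i, vs ! j)) *\<^sub>v block k x j) $ r"
          using pos[of j] \<open>j \<in> {..<nverts}\<close> ir \<pi>c[OF \<open>adj i j\<close>] by simp
      qed
      also have "\<dots> = (rep_adj k \<pi> *\<^sub>v x) $ (i * k + r)"
        using rep_adj_mult_vec[OF \<pi> x(1) ir] by simp
      also have "\<dots> = complex_of_real (?l * p i) * Y i $ r"
        using x block_index[OF ir] ir pos[OF ir(1)] by (simp add: Y_def block_def)
      finally show ?thesis .
    qed
    have expand: "w i j * (\<Sum>r<k. (cmod (Y i $ r - Z i j $ r))\<^sup>2) =
        w i j * N i + w i j * N j - 2 * w i j * (\<Sum>r<k. Re (cnj (Y i $ r) * Z i j $ r))" for i j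
    proof (cases "adj i j")
      case True
      have "(cmod (a - b))\<^sup>2 = (cmod a)\<^sup>2 + (cmod b)\<^sup>2 - 2 * Re (cnj a * b)" for a b
        unfolding cmod_power2 by (simp add: power2_eq_square algebra_simps)
      then have "(\<Sum>r<k. (cmod (Y i $ r - Z i j $ r))\<^sup>2) =
          N i + (\<Sum>r<k. (cmod (Z i j $ r))\<^sup>2) - 2 * (\<Sum>r<k. Re (cnj (Y i $ r) * Z i j $ r))"
        by (simp only: N_def sum.distrib sum_subtractf sum_distrib_left)
      also have "(\<Sum>r<k. (cmod (Z i j $ r))\<^sup>2) = N j"
        unfolding Z_def N_def by (rule unitary_mult_vec_norm[OF uni[OF True] Yc])
      finally show ?thesis by (simp only: distrib_left right_diff_distrib mult_ac)
    qed (simp add: w_def)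
    have part1: "(\<Sum>i<nverts. \<Sum>j<nverts. w i j * N i) = ?l * (\<Sum>i<nverts. (p i)\<^sup>2 * N i)"
      unfolding sum_distrib_left
      by (intro sum.cong refl) (simp add: wsum mult.assoc flip: sum_distrib_right)
    have "(\<Sum>i<nverts. \<Sum>j<nverts. w i j * N j) = (\<Sum>j<nverts. \<Sum>i<nverts. w i j * N j)"
      by (rule sum.swap)
    also have "\<dots> = (\<Sum>i<nverts. \<Sum>j<nverts. w i j * N i)"
      by (intro sum.cong refl) (simp add: wsym)
    finally have part2: "(\<Sum>i<nverts. \<Sum>j<nverts. w i j * N j) = ?l * (\<Sum>i<nverts. (p i)\<^sup>2 * N i)"
      using part1 by simp
    have part3: "(\<Sum>i<nverts. \<Sum>j<nverts. w i j * (\<Sum>r<k. Re (cnj (Y i $ r) * Z i j $ r))) =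
        ?l * (\<Sum>i<nverts. (p i)\<^sup>2 * N i)"
      unfolding sum_distrib_left
    proof (intro sum.cong refl)
      fix i assume i: "i \<in> {..<nverts}"
      have "(\<Sum>j<nverts. \<Sum>r<k. w i j * Re (cnj (Y i $ r) * Z i j $ r)) =
          (\<Sum>r<k. \<Sum>j<nverts. w i j * Re (cnj (Y i $ r) * Z i j $ r))"
        by (rule sum.swap)
      also have "\<dots> = (\<Sum>r<k. Re (complex_of_real (p i) * cnj (Y i $ r) *
          (\<Sum>j<nverts. if adj i j then complex_of_real (p j) * Z i j $ r else 0)))"
        unfolding sum_distrib_left Re_sum
        by (intro sum.cong refl) (simp add: w_def algebra_simps)
      also have "\<dots> = (\<Sum>r<k. ?l * ((p i)\<^sup>2 * (cmod (Y i $ r))\<^sup>2))"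
        unfolding cmod_power2 using i
        by (intro sum.cong refl) (simp add: Zsum power2_eq_square algebra_simps)
      also have "\<dots> = ?l * ((p i)\<^sup>2 * N i)" by (simp add: N_def sum_distrib_left)
      finally show "(\<Sum>j<nverts. \<Sum>r<k. w i j * Re (cnj (Y i $ r) * Z i j $ r)) =
        ?l * ((p i)\<^sup>2 * N i)" .
    qed
    \<comment> \<open>By \<open>part1\<close>, \<open>part2\<close> and \<open>part3\<close> the
      three sums on the right have one common value S, so the total is S + S - 2 S = 0.\<close>
    have "(\<Sum>i<nverts. \<Sum>j<nverts. w i j * (\<Sum>r<k. (cmod (Y i $ r - Z i j $ r))\<^sup>2)) =
        (\<Sum>i<nverts. \<Sum>j<nverts. w i j * N i) + (\<Sum>i<nverts. \<Sum>j<nverts. w i j * N j)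
        - 2 * (\<Sum>i<nverts. \<Sum>j<nverts. w i j * (\<Sum>r<k. Re (cnj (Y i $ r) * Z i j $ r)))"
      unfolding expand sum_subtractf sum.distrib sum_distrib_left[of 2] by (simp add: mult.assoc)
    then have zero: "(\<Sum>i<nverts. \<Sum>j<nverts. w i j * (\<Sum>r<k. (cmod (Y i $ r - Z i j $ r))\<^sup>2)) = 0"
      using part1 part2 part3 by simp
    have nonneg: "w i j * (\<Sum>r<k. (cmod (Y i $ r - Z i j $ r))\<^sup>2) \<ge> 0"
      if "i < nverts" "j < nverts" for i j
      using pos[OF that(1)] pos[OF that(2)] by (simp add: w_def sum_nonneg)
    have "(\<Sum>j<nverts. w i0 j * (\<Sum>r<k. (cmod (Y i0 $ r - Z i0 j $ r))\<^sup>2)) = 0"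
      using zero nonneg ij0 by (subst (asm) sum_nonneg_eq_0_iff) (auto intro!: sum_nonneg)
    then have "w i0 j0 * (\<Sum>r<k. (cmod (Y i0 $ r - Z i0 j0 $ r))\<^sup>2) = 0"
      using nonneg ij0 by (subst (asm) sum_nonneg_eq_0_iff) auto
    then have "(\<Sum>r<k. (cmod (Y i0 $ r - Z i0 j0 $ r))\<^sup>2) = 0"
      using pos[OF ij0(1)] pos[OF ij0(2)] ij0(3) by (simp add: w_def)
    then have "\<forall>r<k. Y i0 $ r = Z i0 j0 $ r" by (simp add: sum_nonneg_eq_0_iff)
    then have "Y i0 = Z i0 j0" using Yc[of i0] Zc[OF ij0(3)] by (intro eq_vecI) auto
    then show ?thesis by (simp add: Y_def Z_def)
  qed
  with pos that show ?thesis by blast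
qed

text \<open>The harmonic relation expresses each block as a linear image of any neighbouring one, so
  a zero block spreads over the connected graph. By linearity a top eigenvector is determined by one
  block.\<close>

lemma top_eigenvector_vanishing_block:
  assumes conn: "connected (with_proj \<Gamma>)" and \<pi>: "unitary_representation G k \<pi>"
    and x: "x \<in> carrier_vec (nverts * k)" "rep_adj k \<pi> *\<^sub>v x = complex_of_real top_eigenvalue \<cdot>\<^sub>v x"
    and i: "i < nverts" "block k x i = 0\<^sub>v k"
  shows "x = 0\<^sub>v (nverts * k)"
proof -
  obtain p :: "nat \<Rightarrow> real" where pos: "\<And>i. i < nverts \<Longrightarrow> p i > 0"
    and harm: "\<And>x i j. x \<in> carrier_vec (nverts * k) \<Longrightarrow>
      rep_adj k \<pi> *\<^sub>v x = complex_of_real top_eigenvalue \<cdot>\<^sub>v x \<Longrightarrow>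
      i < nverts \<Longrightarrow> j < nverts \<Longrightarrow> adj i j \<Longrightarrow>
      complex_of_real (1 / p i) \<cdot>\<^sub>v block k x i =
        \<pi> (\<Psi> (vs ! i, vs ! j)) *\<^sub>v (complex_of_real (1 / p j) \<cdot>\<^sub>v block k x j)"
    using top_eigenvector_harmonic[OF conn \<pi>] by blast
  have zero: "block k x j = 0\<^sub>v k" if "j < nverts" for j
    using conn i that
  proof (rule connected_induct)
    fix i j assume ij: "i < nverts" "j < nverts" "adj i j" "block k x i = 0\<^sub>v k"
    \<comment> \<open>The relation yields the block at its first index from that at its second, so
      the arc is traversed backwards.\<close>
    have ji: "adj j i" using ij(3) arc_sym by blast
    have "\<pi> (\<Psi> (vs ! j, vs ! i)) \<in> carrier_mat k k"
      by (rule unitary_rep_carrier[OF \<pi> gain_carrier[OF ji]])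
    then have "complex_of_real (1 / p j) \<cdot>\<^sub>v block k x j = 0\<^sub>v k"
      using harm[OF x ij(2,1) ji] ij(4)
      by (simp only: smult_vec_zero mult_mat_zero_vec)
    then have "complex_of_real (p j) \<cdot>\<^sub>v (complex_of_real (1 / p j) \<cdot>\<^sub>v block k x j) = 0\<^sub>v k"
      by (simp only: smult_vec_zero)
    then show "block k x j = 0\<^sub>v k" using pos[OF ij(2)] by (simp add: smult_smult_assoc)
  qed
  show ?thesis
  proof (rule eq_vecI)
    fix y assume "y < dim_vec (0\<^sub>v (nverts * k) :: complex vec)"
    then have y: "y < nverts * k" by simp
    then have "k > 0" by (cases k) auto
    then have "y div k < nverts" "y mod k < k" "y = y div k * k + y mod k"
      using y by (simp_all add: less_mult_imp_div_less)
    then have "x $ y = block k x (y div k) $ (y mod k)" by (simp add: block_def)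
    then show "x $ y = 0\<^sub>v (nverts * k) $ y" using zero \<open>y div k < nverts\<close> \<open>y mod k < k\<close> y by simp
  qed (use x in simp)
qed

text \<open>Composing the harmonic relations along a walk, the rescaled block at its start is the
  image under \<open>\<pi>\<close> of the gain of the one at its end. For a closed walk both carry
  the same factor \<open>1 / p i\<close>, which cancels.\<close>

lemma walk_gain_fixes_block:
  assumes conn: "connected (with_proj \<Gamma>)" and \<pi>: "unitary_representation G k \<pi>"
    and x: "x \<in> carrier_vec (nverts * k)" "rep_adj k \<pi> *\<^sub>v x = complex_of_real top_eigenvalue \<cdot>\<^sub>v x"
    and w: "vwalk w (with_proj \<Gamma>)" "hd w = vs ! i" "last w = vs ! i" "i < nverts"
  shows "\<pi> (walk_gain G \<Psi> w) *\<^sub>v block k x i = block k x i"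
proof -
  obtain p :: "nat \<Rightarrow> real" where pos: "\<And>i. i < nverts \<Longrightarrow> p i > 0"
    and harm: "\<And>x i j. x \<in> carrier_vec (nverts * k) \<Longrightarrow>
      rep_adj k \<pi> *\<^sub>v x = complex_of_real top_eigenvalue \<cdot>\<^sub>v x \<Longrightarrow>
      i < nverts \<Longrightarrow> j < nverts \<Longrightarrow> adj i j \<Longrightarrow>
      complex_of_real (1 / p i) \<cdot>\<^sub>v block k x i =
        \<pi> (\<Psi> (vs ! i, vs ! j)) *\<^sub>v (complex_of_real (1 / p j) \<cdot>\<^sub>v block k x j)"
    using top_eigenvector_harmonic[OF conn \<pi>] by blast
  define Y where "Y i = complex_of_real (1 / p i) \<cdot>\<^sub>v block k x i" for i
  have Yc: "Y i \<in> carrier_vec k" for i by (simp add: Y_def)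
  \<comment> \<open>Stated for walks with arbitrary end points, since the tail of a closed walk is
    in general not closed.\<close>
  have "vwalk w (with_proj \<Gamma>) \<Longrightarrow> \<forall>i<nverts. \<forall>j<nverts. hd w = vs ! i \<longrightarrow> last w = vs ! j \<longrightarrow>
      Y i = \<pi> (walk_gain G \<Psi> w) *\<^sub>v Y j" for w
  proof (induction w)
    case Nil
    then show ?case by (simp add: vwalk_def)
  next
    case (Cons u w)
    show ?case
    proof (cases "w = []")
      case True
      then show ?thesis
        using Yc distinct unitary_representation_one[OF group \<pi>]
        by (auto simp: walk_gain_single nth_eq_iff_index_eq)
    next
      case False
      then have vw: "vwalk w (with_proj \<Gamma>)" and arc: "(u, hd w) \<in> parcs \<Gamma>"
        using Cons.prems by (auto elim: vwalk_consE)
      obtain m where m: "m < nverts" "vs ! m = hd w"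
        using arc_verts(2)[OF arc] verts by (metis in_set_conv_nth)
      have g: "\<Psi> (u, hd w) \<in> carrier G" "walk_gain G \<Psi> w \<in> carrier G"
        using gain_carrier[OF arc] walk_gain_carrier[OF vw] by auto
      have "Y i = \<pi> (walk_gain G \<Psi> (u # w)) *\<^sub>v Y j"
        if ij: "i < nverts" "j < nverts" "u = vs ! i" "last w = vs ! j" for i j
      proof -
        have "Y i = \<pi> (\<Psi> (u, hd w)) *\<^sub>v Y m"
          using harm[OF x ij(1) m(1)] arc ij m by (simp add: Y_def)
        also have "Y m = \<pi> (walk_gain G \<Psi> w) *\<^sub>v Y j"
          using Cons.IH[OF vw] m ij by simp
        also have "\<pi> (\<Psi> (u, hd w)) *\<^sub>v (\<pi> (walk_gain G \<Psi> w) *\<^sub>v Y j) =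
            (\<pi> (\<Psi> (u, hd w)) * \<pi> (walk_gain G \<Psi> w)) *\<^sub>v Y j"
          by (rule assoc_mult_mat_vec[symmetric, OF unitary_rep_carrier[OF \<pi> g(1)]
                unitary_rep_carrier[OF \<pi> g(2)] Yc])
        also have "\<pi> (\<Psi> (u, hd w)) * \<pi> (walk_gain G \<Psi> w) = \<pi> (walk_gain G \<Psi> (u # w))"
          using \<pi> g False by (simp add: walk_gain_Cons unitary_representation_iff)
        finally show ?thesis .
      qed
      with False show ?thesis by simp
    qed
  qed
  then have "Y i = \<pi> (walk_gain G \<Psi> w) *\<^sub>v Y i" using w by blast
  also have "\<dots> = complex_of_real (1 / p i) \<cdot>\<^sub>v (\<pi> (walk_gain G \<Psi> w) *\<^sub>v block k x i)"
    unfolding Y_def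
    by (rule mult_mat_vec[OF unitary_rep_carrier[OF \<pi> walk_gain_carrier[OF w(1)]] block_carrier])
  finally have "complex_of_real (p i) \<cdot>\<^sub>v Y i = complex_of_real (p i) \<cdot>\<^sub>v
      (complex_of_real (1 / p i) \<cdot>\<^sub>v (\<pi> (walk_gain G \<Psi> w) *\<^sub>v block k x i))" by simp
  then show ?thesis using pos[OF w(4)] by (simp add: Y_def smult_smult_assoc)
qed

text \<open>The matrix of the map sending a linear combination of \<open>xs\<close>, given by its
  coefficients, to its block at vertex \<open>i\<close>.\<close>

definition evaluation :: "nat \<Rightarrow> complex vec list \<Rightarrow> nat \<Rightarrow> complex mat" where
  "evaluation k xs i = mat_of_cols k (map (\<lambda>x. block k x i) xs)"

lemma evaluation_carrier: "evaluation k xs i \<in> carrier_mat k (length xs)"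
  by (rule carrier_matI) (simp_all add: evaluation_def)

text \<open>A combination of top eigenvectors is killed by the top eigenvalue equation's residual
  and so again obeys that equation; if its block at \<open>i\<close> is zero then it is zero, and
  orthonormality makes the coefficients zero.\<close>

lemma evaluation_injective:
  assumes conn: "connected (with_proj \<Gamma>)" and \<pi>: "unitary_representation G k \<pi>"
    and xs: "orthonormal (nverts * k) xs"
      "\<And>x. x \<in> set xs \<Longrightarrow> rep_adj k \<pi> *\<^sub>v x = complex_of_real top_eigenvalue \<cdot>\<^sub>v x"
    and i: "i < nverts" and c: "c \<in> carrier_vec (length xs)" "evaluation k xs i *\<^sub>v c = 0\<^sub>v k"
  shows "c = 0\<^sub>v (length xs)"
proof -
  let ?n = "nverts * k" and ?m = "length xs" and ?A = "rep_adj k \<pi>"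
  let ?V = "mat_of_cols ?n xs"
  note A = rep_adj_carrier[of k \<pi>]
  have V: "?V \<in> carrier_mat ?n ?m" by simp
  have Vc: "?V *\<^sub>v c \<in> carrier_vec ?n" by (rule mult_mat_vec_carrier[OF V c(1)])
  have AV: "?A * ?V = complex_of_real top_eigenvalue \<cdot>\<^sub>m ?V"
  proof (rule mat_col_eqI)
    fix j assume "j < dim_col (complex_of_real top_eigenvalue \<cdot>\<^sub>m ?V)"
    then have j: "j < ?m" by simp
    have "col ?V j = xs ! j"
      using j orthonormal_carrier[OF xs(1) nth_mem[OF j]] by simp
    then show "col (?A * ?V) j = col (complex_of_real top_eigenvalue \<cdot>\<^sub>m ?V) j"
      using col_mult2[OF A V j] xs(2)[OF nth_mem[OF j]] j by simp
  qed (use A in auto)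
  have "?A *\<^sub>v (?V *\<^sub>v c) = complex_of_real top_eigenvalue \<cdot>\<^sub>v (?V *\<^sub>v c)"
    using assoc_mult_mat_vec[OF A V c(1)] smult_mat_mult_vec[OF V c(1)] AV by simp
  moreover have "block k (?V *\<^sub>v c) i = evaluation k xs i *\<^sub>v c"
  proof (rule eq_vecI)
    fix r assume "r < dim_vec (evaluation k xs i *\<^sub>v c)"
    then have r: "r < k" by (simp add: evaluation_def)
    then show "block k (?V *\<^sub>v c) i $ r = (evaluation k xs i *\<^sub>v c) $ r"
      using block_index[OF i r] c(1)
      by (simp add: block_def evaluation_def scalar_prod_def mat_of_cols_index)
  qed (simp add: block_def evaluation_def)
  ultimately have "?V *\<^sub>v c = 0\<^sub>v ?n"
    using top_eigenvector_vanishing_block[OF conn \<pi> Vc _ i] c(2) by simp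
  then have "mat_adjoint ?V *\<^sub>v (?V *\<^sub>v c) = 0\<^sub>v ?m"
    using mult_mat_zero_vec[OF mat_adjoint_carrier[OF V]] by simp
  moreover have "mat_adjoint ?V *\<^sub>v (?V *\<^sub>v c) = c"
    using assoc_mult_mat_vec[OF mat_adjoint_carrier[OF V] V c(1)] xs(1) c(1)
    by (simp add: orthonormal_def)
  ultimately show ?thesis by simp
qed

text \<open>More than \<open>k\<close> independent eigenvectors would make the evaluation matrix at
  any vertex wide, hence not injective. Index 0 is available because a connected graph has a
  vertex.\<close>

lemma top_eigenvalue_multiplicity_le:
  assumes conn: "connected (with_proj \<Gamma>)" and \<pi>: "unitary_representation G k \<pi>"
  shows "count (spectrum_mset (rep_adj k \<pi>)) (complex_of_real top_eigenvalue) \<le> k"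
proof (rule ccontr)
  obtain xs where xs: "orthonormal (nverts * k) xs"
    "length xs = count (spectrum_mset (rep_adj k \<pi>)) (complex_of_real top_eigenvalue)"
    "\<And>x. x \<in> set xs \<Longrightarrow> rep_adj k \<pi> *\<^sub>v x = complex_of_real top_eigenvalue \<cdot>\<^sub>v x"
    using hermitian_eigenvectors_of_count[OF rep_adj_carrier rep_adj_hermitian[OF \<pi>]] by blast
  assume "\<not> ?thesis"
  then have "k < length xs" using xs(2) by simp
  then obtain c where "c \<in> carrier_vec (length xs)" "c \<noteq> 0\<^sub>v (length xs)"
    "evaluation k xs 0 *\<^sub>v c = 0\<^sub>v k"
    using wide_matrix_kernel[OF evaluation_carrier] by blast
  then show False
    using evaluation_injective[OF conn \<pi> xs(1,3) nverts_pos[OF conn]] by blast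
qed

text \<open>With exactly \<open>k\<close> eigenvectors the evaluation matrix at the base point of
  \<open>w\<close> is square and injective, hence invertible. The matrix of the gain fixes all its
  columns, so it is the identity.\<close>

lemma full_multiplicity_imp_trivial_gain:
  assumes conn: "connected (with_proj \<Gamma>)" and \<pi>: "unitary_representation G k \<pi>"
    and mult: "count (spectrum_mset (rep_adj k \<pi>)) (complex_of_real top_eigenvalue) = k"
    and w: "vwalk w (with_proj \<Gamma>)" "hd w = last w"
  shows "\<pi> (walk_gain G \<Psi> w) = 1\<^sub>m k"
proof -
  obtain xs where xs: "orthonormal (nverts * k) xs"
    "length xs = count (spectrum_mset (rep_adj k \<pi>)) (complex_of_real top_eigenvalue)"
    "\<And>x. x \<in> set xs \<Longrightarrow> rep_adj k \<pi> *\<^sub>v x = complex_of_real top_eigenvalue \<cdot>\<^sub>v x"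
    using hermitian_eigenvectors_of_count[OF rep_adj_carrier rep_adj_hermitian[OF \<pi>]] by blast
  note len = xs(2)[unfolded mult]
  have "hd w \<in> pverts \<Gamma>" using w(1) by (auto simp: vwalk_def)
  then obtain i where i: "i < nverts" "vs ! i = hd w" using verts by (metis in_set_conv_nth)
  let ?M = "\<pi> (walk_gain G \<Psi> w)" and ?E = "evaluation k xs i"
  have M: "?M \<in> carrier_mat k k" by (rule unitary_rep_carrier[OF \<pi> walk_gain_carrier[OF w(1)]])
  have E: "?E \<in> carrier_mat k k" using evaluation_carrier[of k xs i] len by simp
  have ME: "?M * ?E = ?E"
  proof (rule mat_col_eqI)
    fix j assume "j < dim_col ?E"
    then have j: "j < k" using E by simp
    have xj: "xs ! j \<in> set xs" using j len by simp
    have "col ?E j = block k (xs ! j) i"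
      using j len by (simp add: evaluation_def)
    then show "col (?M * ?E) j = col ?E j"
      using col_mult2[OF M E j]
        walk_gain_fixes_block[OF conn \<pi> orthonormal_carrier[OF xs(1) xj] xs(3)[OF xj] w(1)] i w(2)
      by simp
  qed (use M E in auto)
  have "det ?E \<noteq> 0"
    using evaluation_injective[OF conn \<pi> xs(1,3) i(1)] len
    unfolding det_0_iff_vec_prod_zero_field[OF E] by auto
  then obtain B where B: "B \<in> carrier_mat k k" "?E * B = 1\<^sub>m k"
    using det_non_zero_imp_unit[OF E, of "()"] by (auto simp: Units_def ring_mat_simps)
  have "?M = ?M * (?E * B)" using M B by simp
  also have "\<dots> = ?E * B" using assoc_mult_mat[OF M E B(1)] ME by simp
  finally show ?thesis using B(2) by simp
qed

lemma spectrum_imp_top_eigenvalue: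
  assumes conn: "connected (with_proj \<Gamma>)" and k: "k > 0"
    and spec: "spectrum_mset (rep_adj k \<pi>) = repeat_mset k (spectrum_mset (adjacency_matrix \<Gamma> vs))"
  shows "largest_eigenvalue (rep_adj k \<pi>) = top_eigenvalue"
    and "count (spectrum_mset (rep_adj k \<pi>)) (complex_of_real top_eigenvalue) = k"
proof -
  have "set_mset (repeat_mset k M) = set_mset M" for M :: "complex multiset"
    using k by (auto simp flip: count_greater_zero_iff)
  then show "largest_eigenvalue (rep_adj k \<pi>) = top_eigenvalue"
    unfolding largest_eigenvalue_def eigenvalue_iff_spectrum_mset[OF rep_adj_carrier]
      eigenvalue_iff_spectrum_mset[OF adjacency_carrier] spec by simp
  \<comment> \<open>Simplicity of the top eigenvalue: the multiplicity bound for the trivial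
    representation of degree 1.\<close>
  have "count (spectrum_mset (adjacency_matrix \<Gamma> vs)) (complex_of_real top_eigenvalue) \<le> 1"
    using top_eigenvalue_multiplicity_le[OF conn unitary_trivial_representation]
    unfolding adjacency_eq_rep_adj .
  moreover have "count (spectrum_mset (adjacency_matrix \<Gamma> vs)) (complex_of_real top_eigenvalue) > 0"
    using top_eigenvalue_in_spectrum[OF nverts_pos[OF conn]] by simp
  ultimately have "count (spectrum_mset (adjacency_matrix \<Gamma> vs)) (complex_of_real top_eigenvalue) = 1"
    by linarith
  then show "count (spectrum_mset (rep_adj k \<pi>)) (complex_of_real top_eigenvalue) = k"
    unfolding spec by simp
qed

end

theorem corollary3:
  fixes G :: "('g, 'm) monoid_scheme"
    and \<Gamma> :: "'v pair_pre_digraph"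
    and \<Psi> :: "'v \<times> 'v \<Rightarrow> 'g"
    and vs :: "'v list"
  assumes "group G" and "finite (carrier G)"
    and "pair_graph \<Gamma>"
    and "gain_function G \<Gamma> \<Psi>"
    and "distinct vs" and "set vs = pverts \<Gamma>"
  shows
    "(balanced G \<Gamma> \<Psi> \<longleftrightarrow>
       (\<forall>k \<pi>. unitary_representation G k \<pi> \<and> irreducible_representation G k \<pi> \<longrightarrow>
          spectrum_mset (represented_adjacency_matrix \<Gamma> \<Psi> vs k \<pi>) =
          repeat_mset k (spectrum_mset (adjacency_matrix \<Gamma> vs)))) \<and>
     (connected (with_proj \<Gamma>) \<longrightarrow>
       (balanced G \<Gamma> \<Psi> \<longleftrightarrow>
         (\<forall>k \<pi>. unitary_representation G k \<pi> \<and> irreducible_representation G k \<pi> \<longrightarrow>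
            largest_eigenvalue (represented_adjacency_matrix \<Gamma> \<Psi> vs k \<pi>) =
              largest_eigenvalue (adjacency_matrix \<Gamma> vs) \<and>
            count (spectrum_mset (represented_adjacency_matrix \<Gamma> \<Psi> vs k \<pi>))
              (complex_of_real (largest_eigenvalue (adjacency_matrix \<Gamma> vs))) = k)))"
proof -
  interpret enumerated_gain_graph G \<Gamma> \<Psi> vs
    using assms by (simp add: enumerated_gain_graph_def)
  have "balanced G \<Gamma> \<Psi> \<longleftrightarrow>
     (\<forall>k \<pi>. unitary_representation G k \<pi> \<and> irreducible_representation G k \<pi> \<longrightarrow>
        spectrum_mset (rep_adj k \<pi>) = repeat_mset k (spectrum_mset (adjacency_matrix \<Gamma> vs)))"
    using balanced_imp_spectrum balanced_if_trivial_gains[OF assms(2)] spectrum_imp_trivial_gain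
    by blast
  moreover have "balanced G \<Gamma> \<Psi> \<longleftrightarrow>
     (\<forall>k \<pi>. unitary_representation G k \<pi> \<and> irreducible_representation G k \<pi> \<longrightarrow>
        largest_eigenvalue (rep_adj k \<pi>) = top_eigenvalue \<and>
        count (spectrum_mset (rep_adj k \<pi>)) (complex_of_real top_eigenvalue) = k)"
    if conn: "connected (with_proj \<Gamma>)"
  proof
    assume bal: "balanced G \<Gamma> \<Psi>"
    show "\<forall>k \<pi>. unitary_representation G k \<pi> \<and> irreducible_representation G k \<pi> \<longrightarrow>
        largest_eigenvalue (rep_adj k \<pi>) = top_eigenvalue \<and>
        count (spectrum_mset (rep_adj k \<pi>)) (complex_of_real top_eigenvalue) = k"
      \<comment> \<open>Positivity of the degree comes from irreducibility, which excludes the zero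
        space.\<close>
      using spectrum_imp_top_eigenvalue[OF conn _ balanced_imp_spectrum[OF bal]]
      by (simp add: irreducible_representation_def)
  next
    assume "\<forall>k \<pi>. unitary_representation G k \<pi> \<and> irreducible_representation G k \<pi> \<longrightarrow>
        largest_eigenvalue (rep_adj k \<pi>) = top_eigenvalue \<and>
        count (spectrum_mset (rep_adj k \<pi>)) (complex_of_real top_eigenvalue) = k"
    then show "balanced G \<Gamma> \<Psi>"
      using full_multiplicity_imp_trivial_gain[OF conn] by (intro balanced_if_trivial_gains[OF assms(2)]) blast
  qed
  ultimately show ?thesis by blast
qed

end
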